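(* Let $X$ be a Banach space over $\mathbb{K}=\mathbb{R}$ or $\mathbb{C}$ with $\cot X=q>2$, and let $q^{*}$ be the conjugate of $q$. Then $\mathcal{P}_{d,r}(^{2}X)\neq\mathcal{P}(^{2}X)$ for every $1\leq r<q^{*}$; that is, for every such $r$ there is a continuous scalar-valued $2$-homogeneous polynomial on $X$ which is not $r$-dominated. In other words, $\mathcal{P}_X\geq q^{*}$, where $\mathcal{P}_X:=\inf\{r : \mathcal{P}_{d,r}(^{2}X)=\mathcal{P}(^{2}X)\}$.
   Context: $X$ is a Banach space over $\mathbb{K}=\mathbb{R}$ or $\mathbb{C}$, with dual $X^{*}$ and dual unit ball $B_{X^{*}}$. $\cot X$ denotes the infimum of the $q\in[2,\infty]$ such that $X$ has cotype $q$. The conjugate $q^{*}$ of $q$ is given by $\frac1q+\frac1{q^{*}}=1$ (with $\infty^{*}=1$). $\mathcal{P}(^{2}X)$ is the space of all continuous $2$-homogeneous polynomials $P\colon X\to\mathbb{K}$. For $r>0$, a sequence $(x_j)_{j=1}^\infty$ in $X$ is weakly $r$-summable if $\sup_{\varphi\in B_{X^{*}}}\left(\sum_{j=1}^\infty|\varphi(x_j)|^{r}\right)^{1/r}<\infty$. A polynomial $P\in\mathcal{P}(^{2}X)$ is $r$-dominated if $(P(x_j))_{j=1}^\infty\in\ell_{r/2}$ (i.e. $\sum_{j}|P(x_j)|^{r/2}<\infty$) whenever $(x_j)_{j=1}^\infty$ is weakly $r$-summable in $X$. $\mathcal{P}_{d,r}(^{2}X)$ is the set of all $r$-dominated $P\in\mathcal{P}(^{2}X)$.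 In the definition of $\mathcal{P}_X$, $r$ ranges over the positive real numbers and $\inf\emptyset=+\infty$. *)

theory Defs
  imports "HOL-Analysis.Analysis"
begin

text \<open>
  The scalar fields \<open>\<real>\<close> and \<open>\<complex>\<close>, treated uniformly: up to isometric isomorphism,
  the types of this class are exactly \<^typ>\<open>real\<close> and \<^typ>\<open>complex\<close>.
\<close>

class real_or_complex = real_normed_field +
  assumes real_or_complex:
    "(\<forall>z. \<exists>a. z = a *\<^sub>R 1) \<or>
     (\<exists>i. i * i = - 1 \<and> (\<forall>z. \<exists>a b. z = a *\<^sub>R 1 + b *\<^sub>R i \<and> norm z = sqrt (a\<^sup>2 + b\<^sup>2)))"

instance real :: real_or_complex
  by standard auto

instance complex :: real_or_complex
proof
  have "z = Re z *\<^sub>R 1 + Im z *\<^sub>R \<i> \<and> norm z = sqrt ((Re z)\<^sup>2 + (Im z)\<^sup>2)" for z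
    by (simp add: complex_eq_iff cmod_def)
  then show "(\<forall>z::complex. \<exists>a. z = a *\<^sub>R 1) \<or>
     (\<exists>i::complex. i * i = - 1 \<and>
        (\<forall>z. \<exists>a b. z = a *\<^sub>R 1 + b *\<^sub>R i \<and> norm z = sqrt (a\<^sup>2 + b\<^sup>2)))"
    by (metis i_squared)
qed

text \<open>
  A Banach space over the scalar type \<open>'k\<close>: the norm and completeness come from the class
  \<^class>\<open>banach\<close>, the multiplication by scalars is an explicit parameter which extends \<^term>\<open>scaleR\<close>.
\<close>

locale banach_space_over = vector_space scal
  for scal :: "'k::real_or_complex \<Rightarrow> 'x::banach \<Rightarrow> 'x" +
  assumes norm_scal: "norm (scal c x) = norm c * norm x"
    and scal_of_real: "scal (of_real a) x = a *\<^sub>R x"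

lemma banach_space_over_scaleR: "banach_space_over (scaleR :: real \<Rightarrow> 'x::banach \<Rightarrow> 'x)"
  by unfold_locales (auto simp: scaleR_add_right scaleR_add_left)

lemma banach_space_over_complex: "banach_space_over ((*) :: complex \<Rightarrow> complex \<Rightarrow> complex)"
  by unfold_locales (auto simp: norm_mult scaleR_conv_of_real algebra_simps)

text \<open>The closed unit ball of the dual, that is, of the space of continuous \<open>'k\<close>-linear functionals.\<close>

definition dual_ball :: "('k::real_or_complex \<Rightarrow> 'x::banach \<Rightarrow> 'x) \<Rightarrow> ('x \<Rightarrow> 'k) set" where
  "dual_ball scal =
     {\<phi>. Vector_Spaces.linear scal (*) \<phi> \<and> bounded_linear \<phi> \<and> onorm \<phi> \<le> 1}"

text \<open>
  The \<open>L\<^sub>2\<close> norm of \<open>\<Sum>j<n. r\<^sub>j x\<^sub>j\<close> for the Rademacher functions \<open>r\<^sub>j\<close> on \<open>[0,1]\<close>; as these are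
  independent and uniformly distributed on \<open>{-1, 1}\<close>, it is an average over all choices of signs.
\<close>

definition rademacher_norm :: "nat \<Rightarrow> (nat \<Rightarrow> 'x::real_normed_vector) \<Rightarrow> real" where
  "rademacher_norm n x =
     sqrt ((\<Sum>\<epsilon> \<in> {..<n} \<rightarrow>\<^sub>E {- 1, 1}. (norm (\<Sum>j<n. \<epsilon> j *\<^sub>R x j))\<^sup>2) / 2 ^ n)"

definition has_cotype :: "'x::real_normed_vector itself \<Rightarrow> ereal \<Rightarrow> bool" where
  "has_cotype _ q \<longleftrightarrow>
     (\<exists>C. \<forall>n (x :: nat \<Rightarrow> 'x).
        if q = \<infinity> then \<forall>j<n. norm (x j) \<le> C * rademacher_norm n x
        else (\<Sum>j<n. norm (x j) powr real_of_ereal q) powr (1 / real_of_ereal q)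
               \<le> C * rademacher_norm n x)"

text \<open>The number \<open>cot X\<close>.\<close>

definition inf_cotype :: "'x::real_normed_vector itself \<Rightarrow> ereal" where
  "inf_cotype X = Inf {q. 2 \<le> q \<and> has_cotype X q}"

text \<open>Here \<open>A\<close> is only algebraically bilinear; its boundedness follows from the continuity of \<open>P\<close>.\<close>

definition polynomials2 :: "('k::real_or_complex \<Rightarrow> 'x::banach \<Rightarrow> 'x) \<Rightarrow> ('x \<Rightarrow> 'k) set" where
  "polynomials2 scal =
     {P. continuous_on UNIV P \<and>
         (\<exists>A. (\<forall>x. Vector_Spaces.linear scal (*) (\<lambda>y. A x y)) \<and>
              (\<forall>y. Vector_Spaces.linear scal (*) (\<lambda>x. A x y)) \<and>
              (\<forall>x. P x = A x x))}"

definition weakly_summable ::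
    "('k::real_or_complex \<Rightarrow> 'x::banach \<Rightarrow> 'x) \<Rightarrow> real \<Rightarrow> (nat \<Rightarrow> 'x) \<Rightarrow> bool" where
  "weakly_summable scal r x \<longleftrightarrow>
     (\<exists>C. \<forall>\<phi> \<in> dual_ball scal.
        summable (\<lambda>j. norm (\<phi> (x j)) powr r) \<and>
        (\<Sum>j. norm (\<phi> (x j)) powr r) powr (1 / r) \<le> C)"

definition dominated_polynomials2 ::
    "('k::real_or_complex \<Rightarrow> 'x::banach \<Rightarrow> 'x) \<Rightarrow> real \<Rightarrow> ('x \<Rightarrow> 'k) set" where
  "dominated_polynomials2 scal r =
     {P \<in> polynomials2 scal.
        \<forall>x. weakly_summable scal r x \<longrightarrow> summable (\<lambda>j. norm (P (x j)) powr (r / 2))}"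

text \<open>The number \<open>\<P>\<^sub>X\<close>; note that the infimum of the empty set in \<^typ>\<open>ereal\<close> is \<open>\<infinity>\<close>.\<close>

definition inf_dominated :: "('k::real_or_complex \<Rightarrow> 'x::banach \<Rightarrow> 'x) \<Rightarrow> ereal" where
  "inf_dominated scal =
     Inf {ereal r | r. 0 < r \<and> dominated_polynomials2 scal r = polynomials2 scal}"

end

theory Submission
  imports Defs "HOL-Library.Ramsey"
begin

text \<open>
  The conjugate of an exponent greater than \<open>2\<close> is at most \<open>2\<close>, so it suffices to construct, for
  \<open>0 < r < 2\<close>, a continuous 2-homogeneous polynomial which is not \<open>r\<close>-dominated.  Choose
  \<open>2 < p < cot X\<close> with \<open>r (1 - 1/p) < 1\<close>; then \<open>X\<close> fails cotype \<open>p\<close>.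

  The heart of the matter is that a space failing cotype \<open>p\<close> contains, for a constant \<open>C\<close> and every
  \<open>k\<close>, vectors \<open>u\<^sub>1, \<dots>, u\<^sub>k\<close> of norm at least \<open>1\<close> such that \<open>\<parallel>\<Sum>\<^sub>j\<^sub>\<in>\<^sub>S \<plusminus>u\<^sub>j\<parallel> \<le> C |S|\<^bsup>1/p\<^esup>\<close> for all
  \<open>S\<close> and all signs, as for the unit vectors of \<open>\<ell>\<^sub>p\<close>
  (\<open>unconditional_upper_estimate_if_not_cotype\<close>).  For a functional \<open>\<phi>\<close> in the dual ball this bounds
  the sums of \<open>|\<phi>(u\<^sub>j)|\<close> over every index set \<open>S\<close>, so the \<open>j\<close>-th largest of these values is
  \<open>O(j\<^bsup>1/p - 1\<^esup>)\<close>, and \<open>\<Sum>\<^sub>j |\<phi>(u\<^sub>j)|\<^sup>r = O(k\<^bsup>1 - r(1 - 1/p)\<^esup>)\<close>.  On the other hand, if \<open>\<phi>\<^sub>j\<close> norms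
  \<open>u\<^sub>j\<close>, then \<open>\<Sum>\<^sub>j \<plusminus>\<phi>\<^sub>j\<^sup>2\<close> is a polynomial of norm at most \<open>k\<close> whose value at each \<open>u\<^sub>j\<close> has modulus at
  least \<open>\<parallel>u\<^sub>j\<parallel>\<^sup>2\<close> for one of the two choices of the sign of \<open>\<phi>\<^sub>j\<^sup>2\<close>.  Since \<open>1 - 1/p > 1/2\<close>, rapidly growing
  blocks of such vectors, suitably scaled, form a weakly \<open>r\<close>-summable sequence \<open>(x\<^sub>n)\<close> for which there
  are summable weights \<open>c\<^sub>n\<close> with \<open>\<Sum>\<^sub>n (c\<^sub>n \<parallel>x\<^sub>n\<parallel>\<^sup>2)\<^bsup>r/2\<^esup> = \<infinity>\<close>.  A uniform boundedness principle for
  exponents at most \<open>1\<close>, combined with averaging over signs (\<open>not_summable_combination\<close>), produces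
  bounded coefficients \<open>b\<^sub>n\<close> for which \<open>\<Sum>\<^sub>n b\<^sub>n c\<^sub>n \<phi>\<^sub>n\<^sup>2\<close> is not \<open>r\<close>-dominated.

  The vectors \<open>u\<^sub>j\<close> come from two arguments which together give the part of the Maurey-Pisier theorem
  that is relevant here.  The first is an exhaustion.  Suppose that, for some \<open>n\<close>, any \<open>n\<close> vectors of
  comparable norms have a subfamily whose Rademacher average is large compared with its share in the
  cotype inequality.  Combining such subfamilies into blocks shows that the best constant \<open>D\<close> in
  the cotype \<open>p\<close> inequality for \<open>N\<close> vectors satisfies \<open>D \<le> D/2 + 2n\<close>, and \<open>X\<close> has cotype \<open>p\<close>.  So
  in the absence of cotype \<open>p\<close> there are, for every \<open>n\<close>, vectors \<open>z\<^sub>1, \<dots>, z\<^sub>n\<close> with norms in \<open>[1, 2]\<close> for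
  which the mean square of \<open>\<parallel>\<Sum>\<^sub>j\<^sub>\<in>\<^sub>S \<plusminus>z\<^sub>j\<parallel>\<close> is at most \<open>8 |S|\<^bsup>2/p\<^esup>\<close> for every \<open>S\<close>
  (\<open>upper_estimate_if_not_cotype\<close>).  The second argument passes from averages over signs to all signs:
  Ramsey's theorem makes the norms of short combinations independent of the position of the vectors
  in the sequence, and differences of neighbouring vectors of such a sequence are unconditional up to
  a constant.
\<close>

section \<open>Averages over signs\<close>

definition sign_avg :: "'a set \<Rightarrow> (('a \<Rightarrow> real) \<Rightarrow> real) \<Rightarrow> real" where
  "sign_avg S F = (\<Sum>\<epsilon> \<in> S \<rightarrow>\<^sub>E {- 1, 1}. F \<epsilon>) / 2 ^ card S"

definition rad_sq :: "'a set \<Rightarrow> ('a \<Rightarrow> 'x::real_normed_vector) \<Rightarrow> real" where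
  "rad_sq S x = sign_avg S (\<lambda>\<epsilon>. (norm (\<Sum>j\<in>S. \<epsilon> j *\<^sub>R x j))\<^sup>2)"

lemma rademacher_norm_eq: "rademacher_norm n x = sqrt (rad_sq {..<n} x)"
  by (simp add: rademacher_norm_def rad_sq_def sign_avg_def)

lemma card_signs: "finite S \<Longrightarrow> card (S \<rightarrow>\<^sub>E {- 1, 1::real}) = 2 ^ card S"
  by (simp add: card_PiE card_insert_if numeral_2_eq_2)

lemma finite_signs: "finite S \<Longrightarrow> finite (S \<rightarrow>\<^sub>E {- 1, 1::real})"
  by (auto intro: finite_PiE)

lemma sign_avg_const: "finite S \<Longrightarrow> sign_avg S (\<lambda>_. c) = c"
  by (simp add: sign_avg_def card_signs)

lemma sign_avg_add: "sign_avg S (\<lambda>\<epsilon>. F \<epsilon> + G \<epsilon>) = sign_avg S F + sign_avg S G"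
  by (simp add: sign_avg_def sum.distrib add_divide_distrib)

lemma sign_avg_cmult: "sign_avg S (\<lambda>\<epsilon>. c * F \<epsilon>) = c * sign_avg S F"
  by (simp add: sign_avg_def sum_distrib_left)

lemma sign_avg_mono:
  "(\<And>\<epsilon>. \<epsilon> \<in> S \<rightarrow>\<^sub>E {- 1, 1} \<Longrightarrow> F \<epsilon> \<le> G \<epsilon>) \<Longrightarrow> sign_avg S F \<le> sign_avg S G"
  by (simp add: sign_avg_def divide_right_mono sum_mono)

lemma sign_avg_cong:
  "(\<And>\<epsilon>. \<epsilon> \<in> S \<rightarrow>\<^sub>E {- 1, 1} \<Longrightarrow> F \<epsilon> = G \<epsilon>) \<Longrightarrow> sign_avg S F = sign_avg S G"
  by (simp add: sign_avg_def cong: sum.cong)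

lemma sign_avg_nonneg:
  "(\<And>\<epsilon>. \<epsilon> \<in> S \<rightarrow>\<^sub>E {- 1, 1} \<Longrightarrow> 0 \<le> F \<epsilon>) \<Longrightarrow> 0 \<le> sign_avg S F"
  by (simp add: sign_avg_def sum_nonneg)

lemma sign_avg_sum: "sign_avg S (\<lambda>\<epsilon>. \<Sum>i\<in>I. F i \<epsilon>) = (\<Sum>i\<in>I. sign_avg S (F i))"
  unfolding sign_avg_def by (subst sum.swap) (simp add: sum_divide_distrib)

lemma sign_avg_swap:
  "sign_avg S (\<lambda>\<epsilon>. sign_avg T (\<lambda>\<delta>. F \<epsilon> \<delta>)) = sign_avg T (\<lambda>\<delta>. sign_avg S (\<lambda>\<epsilon>. F \<epsilon> \<delta>))"
proof -
  have "sign_avg S (\<lambda>\<epsilon>. sign_avg T (\<lambda>\<delta>. F \<epsilon> \<delta>))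
      = (\<Sum>\<epsilon> \<in> S \<rightarrow>\<^sub>E {- 1, 1}. \<Sum>\<delta> \<in> T \<rightarrow>\<^sub>E {- 1, 1}. F \<epsilon> \<delta>) / 2 ^ card T / 2 ^ card S"
    by (simp add: sign_avg_def sum_divide_distrib)
  also have "\<dots> = (\<Sum>\<delta> \<in> T \<rightarrow>\<^sub>E {- 1, 1}. \<Sum>\<epsilon> \<in> S \<rightarrow>\<^sub>E {- 1, 1}. F \<epsilon> \<delta>) / 2 ^ card T / 2 ^ card S"
    by (subst sum.swap) simp
  also have "\<dots> = sign_avg T (\<lambda>\<delta>. sign_avg S (\<lambda>\<epsilon>. F \<epsilon> \<delta>))"
    by (simp add: sign_avg_def sum_divide_distrib mult.commute)
  finally show ?thesis .
qed

lemma sign_avg_insert: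
  assumes "finite S" "a \<notin> S"
  shows "sign_avg (insert a S) F =
    (sign_avg S (\<lambda>\<epsilon>. F (\<epsilon>(a := 1))) + sign_avg S (\<lambda>\<epsilon>. F (\<epsilon>(a := - 1)))) / 2"
proof -
  have inj: "inj_on (\<lambda>(y, g). g(a := y)) ({- 1, 1::real} \<times> (S \<rightarrow>\<^sub>E {- 1, 1}))"
  proof (rule inj_onI, clarify)
    fix y y' :: real and g g' :: "'a \<Rightarrow> real"
    assume g: "g \<in> S \<rightarrow>\<^sub>E {- 1, 1}" "g' \<in> S \<rightarrow>\<^sub>E {- 1, 1}" and eq: "g(a := y) = g'(a := y')"
    have "y = y'" using fun_cong[OF eq, of a] by simp
    moreover have "g i = g' i" if "i \<in> S" for i
      using fun_cong[OF eq, of i] that assms(2) by (auto split: if_splits)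
    then have "g = g'" using g by (intro PiE_ext[OF g]) auto
    ultimately show "y = y' \<and> g = g'" by simp
  qed
  have "(\<Sum>\<epsilon> \<in> insert a S \<rightarrow>\<^sub>E {- 1, 1}. F \<epsilon>)
      = (\<Sum>(y, g) \<in> {- 1, 1} \<times> (S \<rightarrow>\<^sub>E {- 1, 1}). F (g(a := y)))"
    by (subst PiE_insert_eq, subst sum.reindex[OF inj]) (auto intro!: sum.cong)
  also have "\<dots> = (\<Sum>g \<in> S \<rightarrow>\<^sub>E {- 1, 1}. F (g(a := - 1))) + (\<Sum>g \<in> S \<rightarrow>\<^sub>E {- 1, 1}. F (g(a := 1)))"
    by (subst sum.cartesian_product[symmetric]) simp
  finally show ?thesis
    using assms by (simp add: sign_avg_def add_divide_distrib)
qed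

lemma sign_avg_marginal:
  assumes "finite S" "U \<subseteq> S"
    and loc: "\<And>\<epsilon> \<epsilon>'. (\<And>j. j \<in> U \<Longrightarrow> \<epsilon> j = \<epsilon>' j) \<Longrightarrow> F \<epsilon> = F \<epsilon>'"
  shows "sign_avg S F = sign_avg U F"
proof -
  have "finite U" using assms finite_subset by blast
  have "sign_avg (U \<union> V) F = sign_avg U F" if "finite V" "V \<inter> U = {}" for V
    using that
  proof (induction V)
    case empty then show ?case by simp
  next
    case (insert a V)
    have "F (\<epsilon>(a := c)) = F \<epsilon>" for \<epsilon> c
      using insert.prems by (intro loc) auto
    then show ?case
      using insert \<open>finite U\<close> by (simp add: sign_avg_insert)
  qed
  from this[of "S - U"] show ?thesis
    using assms by (simp add: Un_absorb1 Diff_disjoint Int_commute)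
qed

text \<open>
  Multiplication by fixed signs permutes the sign patterns.
\<close>

lemma sign_avg_flip:
  assumes "finite S" and \<sigma>: "\<And>j. j \<in> S \<Longrightarrow> \<sigma> j \<in> {- 1, 1::real}"
    and loc: "\<And>\<epsilon> \<epsilon>'. (\<And>j. j \<in> S \<Longrightarrow> \<epsilon> j = \<epsilon>' j) \<Longrightarrow> F \<epsilon> = F \<epsilon>'"
  shows "sign_avg S (\<lambda>\<epsilon>. F (\<lambda>j. \<sigma> j * \<epsilon> j)) = sign_avg S F"
proof -
  let ?h = "\<lambda>\<epsilon>. restrict (\<lambda>j. \<sigma> j * \<epsilon> j) S"
  have \<sigma>2: "\<sigma> j * (\<sigma> j * c) = c" if "j \<in> S" for j c using \<sigma>[OF that] by auto
  have hh: "?h (?h \<epsilon>) = \<epsilon>" if "\<epsilon> \<in> S \<rightarrow>\<^sub>E {- 1, 1}" for \<epsilon>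
  proof
    fix j show "?h (?h \<epsilon>) j = \<epsilon> j"
    proof (cases "j \<in> S")
      case True then show ?thesis by (simp only: restrict_apply if_True \<sigma>2)
    next
      case False then show ?thesis using PiE_arb[OF that False] by (simp only: restrict_apply if_False)
    qed
  qed
  have hS: "?h \<epsilon> \<in> S \<rightarrow>\<^sub>E {- 1, 1}" if "\<epsilon> \<in> S \<rightarrow>\<^sub>E {- 1, 1}" for \<epsilon>
  proof (rule restrict_PiE[THEN iffD2], rule Pi_I)
    fix j assume j: "j \<in> S"
    show "\<sigma> j * \<epsilon> j \<in> {- 1, 1}" using \<sigma>[OF j] PiE_mem[OF that j] by auto
  qed
  have "(\<Sum>\<epsilon> \<in> S \<rightarrow>\<^sub>E {- 1, 1}. F (?h \<epsilon>)) = (\<Sum>\<epsilon> \<in> S \<rightarrow>\<^sub>E {- 1, 1}. F \<epsilon>)"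
    by (rule sum.reindex_bij_witness[of _ ?h ?h]) (rule hh hS refl | assumption)+
  moreover have "F (?h \<epsilon>) = F (\<lambda>j. \<sigma> j * \<epsilon> j)" for \<epsilon> by (rule loc) simp
  ultimately show ?thesis by (simp add: sign_avg_def)
qed

lemma sign_avg_le_ex:
  assumes "finite S" "sign_avg S F \<le> c"
  shows "\<exists>\<epsilon> \<in> S \<rightarrow>\<^sub>E {- 1, 1}. F \<epsilon> \<le> c"
proof (rule ccontr)
  assume "\<not> ?thesis"
  then have lt: "c < F \<epsilon>" if "\<epsilon> \<in> S \<rightarrow>\<^sub>E {- 1, 1}" for \<epsilon> using that by (meson not_le)
  have "(S \<rightarrow>\<^sub>E {- 1, 1::real}) \<noteq> {}" by (simp add: PiE_eq_empty_iff)
  with finite_signs[OF assms(1)]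
  have "(\<Sum>\<epsilon> \<in> S \<rightarrow>\<^sub>E {- 1, 1::real}. c) < (\<Sum>\<epsilon> \<in> S \<rightarrow>\<^sub>E {- 1, 1}. F \<epsilon>)"
    by (rule sum_strict_mono) (rule lt)
  then have "sign_avg S (\<lambda>_. c) < sign_avg S F"
    unfolding sign_avg_def by (simp add: divide_strict_right_mono)
  then show False using assms by (simp add: sign_avg_const)
qed

lemma rad_sq_nonneg: "0 \<le> rad_sq S x"
  by (simp add: rad_sq_def sign_avg_nonneg)

lemma norm_sq_mid:
  fixes u v :: "'x::real_normed_vector"
  shows "(norm u)\<^sup>2 \<le> ((norm (u + v))\<^sup>2 + (norm (u - v))\<^sup>2) / 2"
proof -
  have "(u + v) + (u - v) = 2 *\<^sub>R u" by (simp add: scaleR_2)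
  then have "2 * norm u = norm ((u + v) + (u - v))" by simp
  also have "\<dots> \<le> norm (u + v) + norm (u - v)" by (rule norm_triangle_ineq)
  finally have "2 * norm u \<le> norm (u + v) + norm (u - v)" .
  then have "(2 * norm u)\<^sup>2 \<le> (norm (u + v) + norm (u - v))\<^sup>2" by (intro power_mono) auto
  also have "\<dots> \<le> 2 * (norm (u + v))\<^sup>2 + 2 * (norm (u - v))\<^sup>2"
    using zero_le_power2[of "norm (u + v) - norm (u - v)"] unfolding power2_sum power2_diff by linarith
  finally show ?thesis by (simp add: power_mult_distrib)
qed

lemma rad_sq_marginal:
  assumes "finite S" "U \<subseteq> S"
  shows "sign_avg S (\<lambda>\<epsilon>. (norm (\<Sum>j\<in>U. \<epsilon> j *\<^sub>R x j))\<^sup>2) = rad_sq U x"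
  unfolding rad_sq_def by (rule sign_avg_marginal[OF assms]) (simp cong: sum.cong)

text \<open>
  The partial sum over \<open>U\<close> is the midpoint of two signed sums over \<open>S\<close> that differ by a flip of the
  signs outside \<open>U\<close>, and these have the same distribution.
\<close>

lemma rad_sq_mono:
  assumes "finite S" "U \<subseteq> S"
  shows "rad_sq U x \<le> rad_sq S x"
proof -
  let ?\<sigma> = "\<lambda>j. if j \<in> U then 1 else - 1 :: real"
  let ?F = "\<lambda>\<epsilon>. (norm (\<Sum>j\<in>S. \<epsilon> j *\<^sub>R x j))\<^sup>2"
  have flip: "sign_avg S (\<lambda>\<epsilon>. ?F (\<lambda>j. ?\<sigma> j * \<epsilon> j)) = sign_avg S ?F"
    by (rule sign_avg_flip) (use assms in \<open>auto cong: sum.cong\<close>)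
  have "rad_sq U x = sign_avg S (\<lambda>\<epsilon>. (norm (\<Sum>j\<in>U. \<epsilon> j *\<^sub>R x j))\<^sup>2)"
    by (rule rad_sq_marginal[OF assms, symmetric])
  also have "\<dots> \<le> sign_avg S (\<lambda>\<epsilon>. 1/2 * (?F \<epsilon> + ?F (\<lambda>j. ?\<sigma> j * \<epsilon> j)))"
  proof (rule sign_avg_mono)
    fix \<epsilon> :: "'a \<Rightarrow> real"
    let ?u = "\<Sum>j\<in>U. \<epsilon> j *\<^sub>R x j" and ?v = "\<Sum>j\<in>S - U. \<epsilon> j *\<^sub>R x j"
    have "(\<Sum>j\<in>S. \<epsilon> j *\<^sub>R x j) = ?u + ?v"
      using sum.subset_diff[OF assms(2,1), of "\<lambda>j. \<epsilon> j *\<^sub>R x j"] by (simp add: add.commute)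
    moreover have "(\<Sum>j\<in>S. (?\<sigma> j * \<epsilon> j) *\<^sub>R x j) = (\<Sum>j\<in>U. (?\<sigma> j * \<epsilon> j) *\<^sub>R x j) + (\<Sum>j\<in>S-U. (?\<sigma> j * \<epsilon> j) *\<^sub>R x j)"
      using sum.subset_diff[OF assms(2,1), of "\<lambda>j. (?\<sigma> j * \<epsilon> j) *\<^sub>R x j"] by (simp add: add.commute)
    moreover have "(\<Sum>j\<in>U. (?\<sigma> j * \<epsilon> j) *\<^sub>R x j) = ?u" by (rule sum.cong) auto
    moreover have "(\<Sum>j\<in>S-U. (?\<sigma> j * \<epsilon> j) *\<^sub>R x j) = - ?v"
      unfolding sum_negf[symmetric] by (rule sum.cong) auto
    ultimately show "(norm ?u)\<^sup>2 \<le> 1/2 * (?F \<epsilon> + ?F (\<lambda>j. ?\<sigma> j * \<epsilon> j))"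
      using norm_sq_mid[of ?u ?v] by (simp only: add_uminus_conv_diff)
  qed
  also have "\<dots> = rad_sq S x"
    unfolding sign_avg_cmult sign_avg_add flip by (simp add: rad_sq_def)
  finally show ?thesis .
qed

lemma rad_sq_singleton: "rad_sq {a} x = (norm (x a))\<^sup>2"
  using sign_avg_insert[of "{}" a] by (simp add: rad_sq_def sign_avg_def)

lemma norm_le_rad_sq: "finite S \<Longrightarrow> j \<in> S \<Longrightarrow> (norm (x j))\<^sup>2 \<le> rad_sq S x"
  using rad_sq_mono[of S "{j}" x] by (simp add: rad_sq_singleton)

lemma rad_sq_scaleR: "rad_sq S (\<lambda>j. c *\<^sub>R x j) = c\<^sup>2 * rad_sq S x"
proof -
  have "(\<Sum>j\<in>S. \<epsilon> j *\<^sub>R c *\<^sub>R x j) = c *\<^sub>R (\<Sum>j\<in>S. \<epsilon> j *\<^sub>R x j)" for \<epsilon>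
    by (simp add: scaleR_sum_right mult.commute)
  then show ?thesis by (simp add: rad_sq_def power_mult_distrib sign_avg_cmult)
qed

lemma rad_sq_reindex:
  assumes "finite S" "inj_on h S"
  shows "rad_sq (h ` S) x = rad_sq S (x \<circ> h)"
proof -
  have "(\<Sum>\<epsilon>\<in>h ` S \<rightarrow>\<^sub>E {- 1, 1}. (norm (\<Sum>j\<in>h ` S. \<epsilon> j *\<^sub>R x j))\<^sup>2)
      = (\<Sum>\<epsilon>\<in>S \<rightarrow>\<^sub>E {- 1, 1}. (norm (\<Sum>j\<in>S. \<epsilon> j *\<^sub>R x (h j)))\<^sup>2)"
  proof (rule sum.reindex_bij_witness[where j="\<lambda>\<epsilon>. restrict (\<epsilon> \<circ> h) S"
          and i="\<lambda>\<epsilon>. restrict (\<epsilon> \<circ> inv_into S h) (h ` S)"], goal_cases)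
    case (1 a) then show ?case using assms(2) by (auto simp: fun_eq_iff PiE_def extensional_def)
  next
    case (2 a) then show ?case by (auto simp: PiE_iff)
  next
    case (3 a) then show ?case using assms(2) by (auto simp: fun_eq_iff PiE_def extensional_def)
  next
    case (4 a) then show ?case using assms(2) by (auto simp: PiE_iff)
  next
    case (5 a) then show ?case using assms(2) by (simp add: sum.reindex)
  qed
  then show ?thesis using assms by (simp add: rad_sq_def sign_avg_def card_image)
qed

text \<open>
  For fixed signs of the blocks, the combined signs of the vectors in their union are again uniformly
  distributed; so putting independent signs on the blocks of a Rademacher sum does not increase the
  average.
\<close>

lemma rad_sq_blocks:
  fixes x :: "'a \<Rightarrow> 'x::real_normed_vector"
  assumes "finite S" "finite I" and sub: "\<And>i. i \<in> I \<Longrightarrow> B i \<subseteq> S" and disj: "disjoint_family_on B I"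
  shows "sign_avg S (\<lambda>\<epsilon>. rad_sq I (\<lambda>i. \<Sum>j\<in>B i. \<epsilon> j *\<^sub>R x j)) \<le> rad_sq S x"
proof -
  define U where "U = (\<Union>i\<in>I. B i)"
  have U: "U \<subseteq> S" "finite U" using sub assms(1) by (auto simp: U_def intro: finite_subset)
  have eq: "sign_avg S (\<lambda>\<epsilon>. (norm (\<Sum>i\<in>I. \<delta> i *\<^sub>R (\<Sum>j\<in>B i. \<epsilon> j *\<^sub>R x j)))\<^sup>2) = rad_sq U x"
    if \<delta>: "\<delta> \<in> I \<rightarrow>\<^sub>E {- 1, 1}" for \<delta>
  proof -
    define \<sigma> where "\<sigma> j = (if j \<in> U then \<delta> (THE i. i \<in> I \<and> j \<in> B i) else 1)" for j
    have \<sigma>: "\<sigma> j = \<delta> i" if "i \<in> I" "j \<in> B i" for i j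
    proof -
      have "(THE i. i \<in> I \<and> j \<in> B i) = i"
        using that disj by (intro the_equality) (auto simp: disjoint_family_on_def)
      then show ?thesis using that by (auto simp: \<sigma>_def U_def)
    qed
    have \<sigma>1: "\<sigma> j \<in> {- 1, 1}" for j
    proof (cases "j \<in> U")
      case True
      then obtain i where "i \<in> I" "j \<in> B i" by (auto simp: U_def)
      then show ?thesis using \<sigma>[of i j] PiE_mem[OF \<delta>, of i] by simp
    qed (simp add: \<sigma>_def)
    have "(\<Sum>i\<in>I. \<delta> i *\<^sub>R (\<Sum>j\<in>B i. \<epsilon> j *\<^sub>R x j)) = (\<Sum>j\<in>U. (\<sigma> j * \<epsilon> j) *\<^sub>R x j)" for \<epsilon>
    proof -
      have "(\<Sum>j\<in>U. (\<sigma> j * \<epsilon> j) *\<^sub>R x j) = (\<Sum>i\<in>I. \<Sum>j\<in>B i. (\<sigma> j * \<epsilon> j) *\<^sub>R x j)"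
        unfolding U_def
      proof (rule sum.UNION_disjoint)
        show "\<forall>i\<in>I. finite (B i)" using sub assms(1) finite_subset by blast
        show "\<forall>i\<in>I. \<forall>j\<in>I. i \<noteq> j \<longrightarrow> B i \<inter> B j = {}" using disj by (auto simp: disjoint_family_on_def)
      qed fact
      also have "\<dots> = (\<Sum>i\<in>I. \<delta> i *\<^sub>R (\<Sum>j\<in>B i. \<epsilon> j *\<^sub>R x j))"
        using \<sigma> by (auto simp: scaleR_sum_right intro!: sum.cong)
      finally show ?thesis by simp
    qed
    then have "sign_avg S (\<lambda>\<epsilon>. (norm (\<Sum>i\<in>I. \<delta> i *\<^sub>R (\<Sum>j\<in>B i. \<epsilon> j *\<^sub>R x j)))\<^sup>2)
        = sign_avg S (\<lambda>\<epsilon>. (norm (\<Sum>j\<in>U. (\<sigma> j * \<epsilon> j) *\<^sub>R x j))\<^sup>2)" by simp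
    also have "\<dots> = sign_avg S (\<lambda>\<epsilon>. (norm (\<Sum>j\<in>U. \<epsilon> j *\<^sub>R x j))\<^sup>2)"
      by (rule sign_avg_flip[where F="\<lambda>\<epsilon>. (norm (\<Sum>j\<in>U. \<epsilon> j *\<^sub>R x j))\<^sup>2"])
        (use assms U \<sigma>1 in \<open>auto simp: subset_iff cong: sum.cong\<close>)
    also have "\<dots> = rad_sq U x" by (rule rad_sq_marginal[OF assms(1) U(1)])
    finally show ?thesis .
  qed
  have "sign_avg S (\<lambda>\<epsilon>. rad_sq I (\<lambda>i. \<Sum>j\<in>B i. \<epsilon> j *\<^sub>R x j))
      = sign_avg I (\<lambda>\<delta>. sign_avg S (\<lambda>\<epsilon>. (norm (\<Sum>i\<in>I. \<delta> i *\<^sub>R (\<Sum>j\<in>B i. \<epsilon> j *\<^sub>R x j)))\<^sup>2))"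
    unfolding rad_sq_def by (rule sign_avg_swap)
  also have "\<dots> = sign_avg I (\<lambda>\<delta>. rad_sq U x)" by (rule sign_avg_cong) (rule eq)
  also have "\<dots> = rad_sq U x" using assms by (simp add: sign_avg_const)
  also have "\<dots> \<le> rad_sq S x" by (rule rad_sq_mono) fact+
  finally show ?thesis .
qed

text \<open>
  Orthogonality of the Rademacher functions.
\<close>

lemma rad_sq_real:
  fixes b :: "'a \<Rightarrow> real"
  assumes "finite S"
  shows "rad_sq S b = (\<Sum>j\<in>S. (b j)\<^sup>2)"
  using assms
proof (induction S)
  case empty then show ?case by (simp add: rad_sq_def sign_avg_def)
next
  case (insert a S)
  let ?s = "\<lambda>\<epsilon>. \<Sum>j\<in>S. \<epsilon> j * b j"
  have upd: "(norm (\<Sum>j\<in>insert a S. (\<epsilon>(a := c)) j *\<^sub>R b j))\<^sup>2 = (c * b a + ?s \<epsilon>)\<^sup>2" for \<epsilon> c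
  proof -
    have "(\<Sum>j\<in>S. (\<epsilon>(a := c)) j *\<^sub>R b j) = ?s \<epsilon>"
      using insert.hyps by (intro sum.cong) auto
    then show ?thesis using insert.hyps by simp
  qed
  have "rad_sq (insert a S) b = (sign_avg S (\<lambda>\<epsilon>. (b a + ?s \<epsilon>)\<^sup>2) + sign_avg S (\<lambda>\<epsilon>. (- b a + ?s \<epsilon>)\<^sup>2)) / 2"
    unfolding rad_sq_def sign_avg_insert[OF insert.hyps(1,2)] upd by simp
  also have "\<dots> = sign_avg S (\<lambda>\<epsilon>. ((b a + ?s \<epsilon>)\<^sup>2 + (- b a + ?s \<epsilon>)\<^sup>2)) / 2"
    by (simp add: sign_avg_add)
  also have "\<dots> = sign_avg S (\<lambda>\<epsilon>. 2 * ((b a)\<^sup>2 + (?s \<epsilon>)\<^sup>2)) / 2"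
    by (rule arg_cong[where f="\<lambda>x. x / 2"], rule sign_avg_cong) (simp add: power2_eq_square algebra_simps)
  also have "\<dots> = (b a)\<^sup>2 + rad_sq S b"
    by (simp only: sign_avg_cmult sign_avg_add) (simp add: sign_avg_const insert.hyps rad_sq_def)
  finally show ?case using insert by simp
qed

section \<open>Long sequences with small Rademacher averages\<close>

lemma convex_on_powr_nonneg:
  assumes "1 \<le> \<theta>"
  shows "convex_on {0..} (\<lambda>x::real. x powr \<theta>)"
proof (rule convex_onI)
  have scale: "(s * x) powr \<theta> \<le> s * x powr \<theta>" if "0 < s" "s < 1" "0 \<le> x" for s x :: real
    using that powr_le_one_le[of s \<theta>] assms by (simp add: powr_mult mult_right_mono)
  fix t x y :: real assume t: "0 < t" "t < 1" and xy: "x \<in> {0..}" "y \<in> {0..}"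
  consider "x = 0" | "y = 0" | "x > 0" "y > 0" using xy by force
  then show "((1 - t) *\<^sub>R x + t *\<^sub>R y) powr \<theta> \<le> (1 - t) * x powr \<theta> + t * y powr \<theta>"
  proof cases
    case 1 then show ?thesis using scale[of t y] t xy by simp
  next
    case 2 then show ?thesis using scale[of "1 - t" x] t xy by simp
  next
    case 3 then show ?thesis using convex_onD[OF powr_convex[OF assms], of t x y] t by simp
  qed
qed (rule convex_real_interval)

text \<open>
  Minkowski's inequality in \<open>\<ell>\<^sub>\<theta>\<close> for averages: if the vectors \<open>(g\<^sub>i(\<omega>))\<^sub>i\<close> have \<open>\<ell>\<^sub>\<theta>\<close> norm at most
  \<open>D\<^bsup>1/\<theta>\<^esup> \<Phi>(\<omega>)\<close>, then their sum over \<open>\<omega>\<close> has \<open>\<ell>\<^sub>\<theta>\<close> norm at most \<open>D\<^bsup>1/\<theta>\<^esup>\<close> times the sum of the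
  \<open>\<Phi>(\<omega>)\<close>.  It is Jensen's inequality for the probability weights \<open>\<Phi>(\<omega>) / \<Sum>\<Phi>\<close>.
\<close>

lemma sum_powr_average_le:
  fixes g :: "'i \<Rightarrow> 'w \<Rightarrow> real"
  assumes fin: "finite \<Omega>" and \<theta>: "1 \<le> \<theta>"
    and g: "\<And>i \<omega>. i \<in> I \<Longrightarrow> \<omega> \<in> \<Omega> \<Longrightarrow> 0 \<le> g i \<omega>" and \<Phi>: "\<And>\<omega>. \<omega> \<in> \<Omega> \<Longrightarrow> 0 \<le> \<Phi> \<omega>"
    and finI: "finite I"
    and le: "\<And>\<omega>. \<omega> \<in> \<Omega> \<Longrightarrow> (\<Sum>i\<in>I. g i \<omega> powr \<theta>) \<le> D * \<Phi> \<omega> powr \<theta>"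
  shows "(\<Sum>i\<in>I. (\<Sum>\<omega>\<in>\<Omega>. g i \<omega>) powr \<theta>) \<le> D * (\<Sum>\<omega>\<in>\<Omega>. \<Phi> \<omega>) powr \<theta>"
proof -
  define N where "N = (\<Sum>\<omega>\<in>\<Omega>. \<Phi> \<omega>)"
  have g0: "g i \<omega> = 0" if "i \<in> I" "\<omega> \<in> \<Omega>" "\<Phi> \<omega> = 0" for i \<omega>
  proof -
    have "g i \<omega> powr \<theta> \<le> (\<Sum>i\<in>I. g i \<omega> powr \<theta>)"
      by (rule member_le_sum) (use that finI in auto)
    also have "\<dots> \<le> 0" using le[OF that(2)] that(3) by simp
    finally show ?thesis by simp
  qed
  show ?thesis
  proof (cases "N = 0")
    case True
    then have "\<Phi> \<omega> = 0" if "\<omega> \<in> \<Omega>" for \<omega>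
      using that \<Phi> fin sum_nonneg_eq_0_iff[of \<Omega> \<Phi>] by (simp add: N_def)
    then show ?thesis using g0 by (simp add: sum_nonneg_eq_0_iff)
  next
    case False
    then have N: "N > 0" using \<Phi> by (simp add: N_def sum_nonneg less_le)
    then have ne: "\<Omega> \<noteq> {}" by (auto simp: N_def)
    let ?w = "\<lambda>\<omega>. \<Phi> \<omega> / N" and ?h = "\<lambda>i \<omega>. g i \<omega> / \<Phi> \<omega>"
    have w1: "(\<Sum>\<omega>\<in>\<Omega>. ?w \<omega>) = 1" using N by (simp add: sum_divide_distrib[symmetric] N_def)
    have "(\<Sum>\<omega>\<in>\<Omega>. g i \<omega>) powr \<theta> \<le> N powr \<theta> * (\<Sum>\<omega>\<in>\<Omega>. ?w \<omega> * ?h i \<omega> powr \<theta>)" if i: "i \<in> I" for i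
    proof -
      have "(\<Sum>\<omega>\<in>\<Omega>. g i \<omega>) = N * (\<Sum>\<omega>\<in>\<Omega>. ?w \<omega> *\<^sub>R ?h i \<omega>)"
        unfolding sum_distrib_left using g0[OF i] N by (intro sum.cong) auto
      moreover have "(\<Sum>\<omega>\<in>\<Omega>. ?w \<omega> *\<^sub>R ?h i \<omega>) powr \<theta> \<le> (\<Sum>\<omega>\<in>\<Omega>. ?w \<omega> * ?h i \<omega> powr \<theta>)"
        by (rule convex_on_sum[OF fin ne convex_on_powr_nonneg[OF \<theta>] w1])
          (use \<Phi> N g[OF i] in auto)
      moreover have "0 \<le> (\<Sum>\<omega>\<in>\<Omega>. ?w \<omega> *\<^sub>R ?h i \<omega>)"
        using \<Phi> N g[OF i] by (intro sum_nonneg) auto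
      ultimately show ?thesis using N by (simp add: powr_mult mult_left_mono)
    qed
    then have "(\<Sum>i\<in>I. (\<Sum>\<omega>\<in>\<Omega>. g i \<omega>) powr \<theta>)
        \<le> (\<Sum>i\<in>I. N powr \<theta> * (\<Sum>\<omega>\<in>\<Omega>. ?w \<omega> * ?h i \<omega> powr \<theta>))"
      by (rule sum_mono)
    also have "\<dots> = N powr \<theta> * (\<Sum>\<omega>\<in>\<Omega>. ?w \<omega> * (\<Sum>i\<in>I. ?h i \<omega> powr \<theta>))"
      unfolding sum_distrib_left[symmetric] by (subst sum.swap) (simp add: sum_distrib_left)
    also have "\<dots> \<le> N powr \<theta> * (\<Sum>\<omega>\<in>\<Omega>. ?w \<omega> * D)"
    proof (rule mult_left_mono, rule sum_mono)
      fix \<omega> assume \<omega>: "\<omega> \<in> \<Omega>"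
      show "?w \<omega> * (\<Sum>i\<in>I. ?h i \<omega> powr \<theta>) \<le> ?w \<omega> * D"
      proof (cases "\<Phi> \<omega> = 0")
        case False
        then have pos: "\<Phi> \<omega> > 0" using \<Phi>[OF \<omega>] by simp
        have "(\<Sum>i\<in>I. ?h i \<omega> powr \<theta>) = (\<Sum>i\<in>I. g i \<omega> powr \<theta>) / \<Phi> \<omega> powr \<theta>"
          unfolding sum_divide_distrib using g \<omega> pos by (intro sum.cong) (auto simp: powr_divide)
        also have "\<dots> \<le> D" using le[OF \<omega>] pos by (simp add: pos_divide_le_eq)
        finally show ?thesis using pos N by (intro mult_left_mono) auto
      qed simp
    qed simp
    also have "\<dots> = D * N powr \<theta>"
      by (simp only: sum_distrib_right[symmetric] w1 mult_1_left mult.commute[of "N powr \<theta>"])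
    finally show ?thesis unfolding N_def .
  qed
qed

lemma sum_powr_sign_avg_le:
  assumes "finite S" "finite I" "1 \<le> \<theta>"
    and "\<And>i \<epsilon>. i \<in> I \<Longrightarrow> 0 \<le> g i \<epsilon>" "\<And>\<epsilon>. 0 \<le> \<Phi> \<epsilon>"
    and "\<And>\<epsilon>. (\<Sum>i\<in>I. g i \<epsilon> powr \<theta>) \<le> D * \<Phi> \<epsilon> powr \<theta>"
  shows "(\<Sum>i\<in>I. sign_avg S (g i) powr \<theta>) \<le> D * sign_avg S \<Phi> powr \<theta>"
proof -
  let ?c = "((2::real) ^ card S) powr \<theta>" and ?\<Omega> = "S \<rightarrow>\<^sub>E {- 1, 1::real}"
  have "sign_avg S F powr \<theta> = (\<Sum>\<epsilon>\<in>?\<Omega>. F \<epsilon>) powr \<theta> / ?c" if "\<And>\<epsilon>. 0 \<le> F \<epsilon>" for F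
    unfolding sign_avg_def by (rule powr_divide)
  moreover have "(\<Sum>i\<in>I. (\<Sum>\<epsilon>\<in>?\<Omega>. g i \<epsilon>) powr \<theta>) \<le> D * (\<Sum>\<epsilon>\<in>?\<Omega>. \<Phi> \<epsilon>) powr \<theta>"
    using assms finite_signs by (intro sum_powr_average_le) auto
  moreover have "?c > 0" by simp
  ultimately show ?thesis
    using assms by (simp add: sum_divide_distrib[symmetric] divide_right_mono)
qed

text \<open>
  If no \<open>n\<close> of the numbers lie within a factor \<open>2\<close> of each other, then fewer than \<open>n\<close> of them exceed
  half of the maximum; removing these halves the maximum, which leads to a geometric series.
\<close>

lemma sum_powr_lacunary:
  fixes a :: "'a \<Rightarrow> real"
  assumes "finite L" and p: "1 \<le> p"
    and "\<And>j. j \<in> L \<Longrightarrow> 0 \<le> a j" "\<And>j. j \<in> L \<Longrightarrow> a j \<le> R" "0 \<le> R"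
    and "\<And>T m. T \<subseteq> L \<Longrightarrow> card T = n \<Longrightarrow> finite T \<Longrightarrow> 0 < m \<Longrightarrow> \<not> (\<forall>j\<in>T. m \<le> a j \<and> a j \<le> 2 * m)"
  shows "(\<Sum>j\<in>L. a j powr p) \<le> 2 * real n * R powr p"
  using assms(1,3-)
proof (induction "card L" arbitrary: L R rule: less_induct)
  case less
  show ?case
  proof (cases "\<exists>j\<in>L. a j > 0")
    case False
    then have "\<And>j. j \<in> L \<Longrightarrow> a j = 0" using less.prems(2) by fastforce
    then show ?thesis by simp
  next
    case True
    define M where "M = Max (a ` L)"
    have "finite (a ` L)" "a ` L \<noteq> {}" using True less.prems(1) by auto
    then have M: "M \<in> a ` L" "\<And>j. j \<in> L \<Longrightarrow> a j \<le> M"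
      unfolding M_def by (rule Max_in) (use less.prems(1) in auto)
    have "0 < M" using M(2) True by force
    have "M \<le> R" using M(1) less.prems(3) by auto
    define A where "A = {j\<in>L. M / 2 \<le> a j}"
    have A: "A \<subseteq> L" "finite A" using less.prems(1) by (auto simp: A_def)
    have "card A < n"
    proof (rule ccontr)
      assume "\<not> card A < n"
      then obtain T where T: "T \<subseteq> A" "card T = n" "finite T"
        by (meson not_less obtain_subset_with_card_n)
      then have "T \<subseteq> L" using A by blast
      moreover have "\<forall>j\<in>T. M / 2 \<le> a j \<and> a j \<le> 2 * (M / 2)"
        using T(1) M(2) by (auto simp: A_def)
      ultimately show False
        using less.prems(5)[OF _ T(2,3), of "M / 2"] \<open>0 < M\<close> by (meson half_gt_zero)
    qed
    have "A \<noteq> {}" using M(1) \<open>0 < M\<close> by (auto simp: A_def)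
    then have "card (L - A) < card L"
      using A less.prems(1) by (intro psubset_card_mono) auto
    then have "(\<Sum>j\<in>L - A. a j powr p) \<le> 2 * real n * (M / 2) powr p"
    proof (rule less.hyps)
      show "finite (L - A)" using less.prems(1) by simp
      show "0 \<le> M / 2" using \<open>0 < M\<close> by simp
    next
      fix T and m :: real assume "T \<subseteq> L - A" "card T = n" "finite T" "0 < m"
      then show "\<not> (\<forall>j\<in>T. m \<le> a j \<and> a j \<le> 2 * m)"
        by (intro less.prems(5)) auto
    qed (use less.prems(2) in \<open>auto simp: A_def\<close>)
    also have "\<dots> \<le> n * M powr p"
    proof -
      have "(1 / 2) powr p \<le> (1 / 2 :: real)" using p by (intro powr_le_one_le) auto
      then have "(M / 2) powr p \<le> M powr p / 2"
        using \<open>0 < M\<close> by (simp add: powr_divide field_simps)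
      then show ?thesis using mult_left_mono[of "(M/2) powr p" _ "2 * real n"] by fastforce
    qed
    finally have "(\<Sum>j\<in>L - A. a j powr p) \<le> n * M powr p" .
    moreover have "(\<Sum>j\<in>A. a j powr p) \<le> n * M powr p"
    proof -
      have "(\<Sum>j\<in>A. a j powr p) \<le> (\<Sum>j\<in>A. M powr p)"
        using A M(2) less.prems(2) p by (intro sum_mono powr_mono2) auto
      also have "\<dots> \<le> n * M powr p" using \<open>card A < n\<close> by (simp add: mult_right_mono)
      finally show ?thesis .
    qed
    moreover have "(\<Sum>j\<in>L. a j powr p) = (\<Sum>j\<in>L - A. a j powr p) + (\<Sum>j\<in>A. a j powr p)"
      by (rule sum.subset_diff) fact+
    moreover have "n * M powr p \<le> n * R powr p"
      using \<open>0 < M\<close> \<open>M \<le> R\<close> p by (intro mult_left_mono powr_mono2) auto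
    ultimately show ?thesis by linarith
  qed
qed

text \<open>
  The bound on the number of vectors makes a finite constant available for every space
  (\<open>cotype_const_trivial\<close>), which can then be improved independently of that number.
\<close>

definition cotype_const :: "'x::real_normed_vector itself \<Rightarrow> real \<Rightarrow> nat \<Rightarrow> real \<Rightarrow> bool" where
  "cotype_const _ p n D \<longleftrightarrow>
     (\<forall>S (x :: nat \<Rightarrow> 'x). finite S \<and> card S \<le> n \<longrightarrow>
        (\<Sum>j\<in>S. norm (x j) powr p) \<le> D * rad_sq S x powr (p / 2))"

lemma square_powr_half: "0 \<le> a \<Longrightarrow> (a\<^sup>2) powr (p / 2) = a powr (p::real)"
  by (simp add: powr_powr flip: powr_numeral)

lemma norm_powr_le_rad_sq:
  assumes "finite S" "j \<in> S" "0 < p"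
  shows "norm (x j) powr p \<le> rad_sq S x powr (p / 2)"
proof -
  have "norm (x j) powr p = ((norm (x j))\<^sup>2) powr (p / 2)"
    by (simp add: powr_powr flip: powr_numeral)
  also have "\<dots> \<le> rad_sq S x powr (p / 2)"
    using assms norm_le_rad_sq[OF assms(1,2), of x] by (intro powr_mono2) auto
  finally show ?thesis .
qed

lemma cotype_const_trivial:
  assumes "0 < p" shows "cotype_const TYPE('x::real_normed_vector) p n n"
  unfolding cotype_const_def
proof (intro allI impI, elim conjE)
  fix S :: "nat set" and x :: "nat \<Rightarrow> 'x" assume S: "finite S" "card S \<le> n"
  have "(\<Sum>j\<in>S. norm (x j) powr p) \<le> (\<Sum>j\<in>S. rad_sq S x powr (p / 2))"
    using S assms by (intro sum_mono norm_powr_le_rad_sq) auto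
  also have "\<dots> \<le> n * rad_sq S x powr (p / 2)" using S by (simp add: mult_right_mono)
  finally show "(\<Sum>j\<in>S. norm (x j) powr p) \<le> n * rad_sq S x powr (p / 2)" .
qed

text \<open>
  Choose a maximal disjoint family of subsets whose Rademacher average is at least twice their share
  in the cotype inequality.  The remaining vectors are lacunary and contribute at most \<open>2 n0\<close>.  The
  sums over the members of the family are at most as many vectors as before; applying the cotype
  inequality to them for every choice of inner signs gains the factor \<open>2\<close>.
\<close>

lemma cotype_const_improve:
  fixes D p :: real
  assumes p: "2 \<le> p"
    and bad: "\<And>T (x :: nat \<Rightarrow> 'x::real_normed_vector) m. finite T \<Longrightarrow> card T = n0 \<Longrightarrow> 0 < m \<Longrightarrow>
      (\<And>j. j \<in> T \<Longrightarrow> m \<le> norm (x j) \<and> norm (x j) \<le> 2 * m) \<Longrightarrow>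
      \<exists>S\<subseteq>T. S \<noteq> {} \<and> 2 * (\<Sum>j\<in>S. norm (x j) powr p) \<le> rad_sq S x powr (p / 2)"
    and D: "cotype_const TYPE('x) p n D"
  shows "cotype_const TYPE('x) p n (D / 2 + 2 * n0)"
  unfolding cotype_const_def
proof (intro allI impI, elim conjE)
  fix S :: "nat set" and x :: "nat \<Rightarrow> 'x" assume S: "finite S" "card S \<le> n"
  define W where "W b = (\<Sum>j\<in>b. norm (x j) powr p)" for b
  define fam where "fam = {\<B>. \<B> \<subseteq> {b. b \<subseteq> S \<and> b \<noteq> {} \<and> 2 * W b \<le> rad_sq b x powr (p / 2)} \<and> disjoint \<B>}"
  have "finite fam" using S(1) by (rule_tac finite_subset[of _ "Pow (Pow S)"]) (auto simp: fam_def)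
  moreover have "{} \<in> fam" by (simp add: fam_def)
  ultimately obtain \<B> where \<B>: "\<B> \<in> fam" and max: "\<And>\<B>'. \<B>' \<in> fam \<Longrightarrow> card (\<Union>\<B>') \<le> card (\<Union>\<B>)"
    using obtains_MAX[of fam "\<lambda>\<B>. card (\<Union>\<B>)"] by (metis (no_types, lifting) Max_ge finite_imageI imageI empty_iff)
  have \<B>S: "b \<subseteq> S" "b \<noteq> {}" "2 * W b \<le> rad_sq b x powr (p / 2)" "finite b" if "b \<in> \<B>" for b
    using that \<B> S(1) finite_subset by (auto simp: fam_def)
  have disj: "disjoint \<B>" using \<B> by (simp add: fam_def)
  define U where "U = \<Union>\<B>"
  have U: "U \<subseteq> S" "finite U" using \<B>S S(1) finite_subset[of U S] by (auto simp: U_def)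
  have fin\<B>: "finite \<B>" using \<B>S(1) S(1) by (rule_tac finite_subset[of _ "Pow S"]) auto
  have rest: "W (S - U) \<le> 2 * real n0 * rad_sq S x powr (p / 2)"
  proof -
    let ?R = "sqrt (rad_sq S x)"
    have "W (S - U) \<le> 2 * real n0 * ?R powr p"
      unfolding W_def
    proof (rule sum_powr_lacunary)
      fix j assume "j \<in> S - U"
      then show "norm (x j) \<le> ?R" using norm_le_rad_sq[OF S(1), of j x] by (simp add: real_le_rsqrt)
    next
      fix T and m :: real assume T: "T \<subseteq> S - U" "card T = n0" "finite T" "0 < m"
      show "\<not> (\<forall>j\<in>T. m \<le> norm (x j) \<and> norm (x j) \<le> 2 * m)"
      proof
        assume "\<forall>j\<in>T. m \<le> norm (x j) \<and> norm (x j) \<le> 2 * m"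
        then obtain b where b: "b \<subseteq> T" "b \<noteq> {}" "2 * W b \<le> rad_sq b x powr (p / 2)"
          using bad[OF T(3,2,4), of x] by (auto simp: W_def)
        have bU: "b \<inter> U = {}" "b \<subseteq> S" using b T by auto
        then have "insert b \<B> \<in> fam"
          using \<B> b by (auto simp: fam_def disjoint_def U_def)
        from max[OF this] have "card (b \<union> U) \<le> card U" by (simp add: U_def)
        moreover have "finite b" using b T finite_subset by blast
        ultimately show False using bU b U by (simp add: card_Un_disjoint)
      qed
    qed (use S p rad_sq_nonneg in auto)
    also have "?R powr p = rad_sq S x powr (p / 2)"
      by (simp add: powr_half_sqrt[symmetric] rad_sq_nonneg powr_powr)
    finally show ?thesis .
  qed
  have blocks: "2 * W U \<le> D * rad_sq S x powr (p / 2)"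
  proof -
    obtain f where f: "bij_betw f {0..<card \<B>} \<B>" using ex_bij_betw_nat_finite[OF fin\<B>] by blast
    let ?I = "{0..<card \<B>}"
    have f\<B>: "f i \<in> \<B>" if "i \<in> ?I" for i using f that by (auto simp: bij_betw_def)
    have "card \<B> \<le> card S"
    proof (rule card_inj_on_le)
      show "inj_on Min \<B>"
      proof (rule inj_onI)
        fix b c assume bc: "b \<in> \<B>" "c \<in> \<B>" "Min b = Min c"
        then have "Min b \<in> b \<inter> c" using \<B>S(2,4) Min_in by (metis IntI)
        then show "b = c" using disj bc by (auto simp: disjoint_def)
      qed
      show "Min ` \<B> \<subseteq> S" using \<B>S Min_in by blast
    qed (fact S)
    then have cardI: "card ?I \<le> n" using S by simp
    have disjf: "disjoint_family_on f ?I"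
      unfolding disjoint_family_on_def
    proof (intro ballI impI)
      fix i j assume ij: "i \<in> ?I" "j \<in> ?I" "i \<noteq> j"
      then have "f i \<noteq> f j" using f by (auto simp: bij_betw_def inj_on_def)
      then show "f i \<inter> f j = {}" using disj f\<B> ij by (auto simp: disjoint_def)
    qed
    define y where "y \<epsilon> i = (\<Sum>j\<in>f i. \<epsilon> j *\<^sub>R x j)" for \<epsilon> i
    define g where "g i \<epsilon> = (norm (y \<epsilon> i))\<^sup>2" for i \<epsilon>
    have avg_g: "sign_avg S (g i) = rad_sq (f i) x" if "i \<in> ?I" for i
      unfolding g_def y_def using \<B>S(1)[OF f\<B>[OF that]] by (rule rad_sq_marginal[OF S(1)])
    have "2 * W U = (\<Sum>b\<in>\<B>. 2 * W b)"
      unfolding U_def W_def sum_distrib_left[symmetric]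
      using disj \<B>S(4) by (subst sum.Union_disjoint) (auto simp: disjoint_def)
    also have "\<dots> = (\<Sum>i\<in>?I. 2 * W (f i))" by (rule sum.reindex_bij_betw[OF f, symmetric])
    also have "\<dots> \<le> (\<Sum>i\<in>?I. sign_avg S (g i) powr (p / 2))"
      using \<B>S(3)[OF f\<B>] by (intro sum_mono) (simp add: avg_g)
    also have "\<dots> \<le> D * sign_avg S (\<lambda>\<epsilon>. rad_sq ?I (y \<epsilon>)) powr (p / 2)"
    proof (rule sum_powr_sign_avg_le)
      fix \<epsilon> :: "nat \<Rightarrow> real"
      have "(\<Sum>i\<in>?I. g i \<epsilon> powr (p / 2)) = (\<Sum>i\<in>?I. norm (y \<epsilon> i) powr p)"
        by (intro sum.cong) (auto simp: g_def powr_powr simp flip: powr_numeral)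
      also have "\<dots> \<le> D * rad_sq ?I (y \<epsilon>) powr (p / 2)"
        using D cardI unfolding cotype_const_def by blast
      finally show "(\<Sum>i\<in>?I. g i \<epsilon> powr (p / 2)) \<le> D * rad_sq ?I (y \<epsilon>) powr (p / 2)" .
    qed (use S p in \<open>auto simp: g_def rad_sq_nonneg\<close>)
    also have "\<dots> \<le> D * rad_sq S x powr (p / 2)"
    proof (cases "D \<ge> 0")
      case True
      have "sign_avg S (\<lambda>\<epsilon>. rad_sq ?I (y \<epsilon>)) \<le> rad_sq S x"
        unfolding y_def using \<B>S(1)[OF f\<B>] disjf by (intro rad_sq_blocks S) auto
      then show ?thesis using True p
        by (intro mult_left_mono powr_mono2 sign_avg_nonneg) (auto simp: rad_sq_nonneg)
    next
      case False
      \<comment> \<open>A negative \<open>D\<close> is possible only if the Rademacher average is zero.\<close>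
      have "0 \<le> (\<Sum>j\<in>S. norm (x j) powr p)" by (simp add: sum_nonneg)
      also have "\<dots> \<le> D * rad_sq S x powr (p / 2)" using D S unfolding cotype_const_def by blast
      finally have "rad_sq S x powr (p / 2) = 0" using False by (simp add: zero_le_mult_iff)
      then show ?thesis using False by (simp add: mult_nonpos_nonneg)
    qed
    finally show ?thesis .
  qed
  have "(\<Sum>j\<in>S. norm (x j) powr p) = W (S - U) + W U"
    unfolding W_def by (rule sum.subset_diff) (use U S in auto)
  then show "(\<Sum>j\<in>S. norm (x j) powr p) \<le> (D / 2 + 2 * n0) * rad_sq S x powr (p / 2)"
    using rest blocks by (simp add: algebra_simps)
qed

lemma has_cotypeI:
  assumes p: "2 \<le> p" and le: "\<And>n. cotype_const TYPE('x::real_normed_vector) p n D"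
  shows "has_cotype TYPE('x) (ereal p)"
  unfolding has_cotype_def
proof (intro exI[of _ "\<bar>D\<bar> powr (1 / p)"] allI)
  fix n and x :: "nat \<Rightarrow> 'x"
  have "(\<Sum>j<n. norm (x j) powr p) \<le> D * rad_sq {..<n} x powr (p / 2)"
    using le[of n] by (simp add: cotype_const_def)
  also have "\<dots> \<le> \<bar>D\<bar> * rad_sq {..<n} x powr (p / 2)" by (intro mult_right_mono) auto
  finally have "(\<Sum>j<n. norm (x j) powr p) powr (1 / p) \<le> (\<bar>D\<bar> * rad_sq {..<n} x powr (p / 2)) powr (1 / p)"
    using p by (intro powr_mono2) (auto intro: sum_nonneg)
  also have "\<dots> = \<bar>D\<bar> powr (1 / p) * rademacher_norm n x"
    using p by (simp add: powr_mult powr_powr powr_half_sqrt rad_sq_nonneg rademacher_norm_eq)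
  finally show "if ereal p = \<infinity> then \<forall>j<n. norm (x j) \<le> \<bar>D\<bar> powr (1 / p) * rademacher_norm n x
        else (\<Sum>j<n. norm (x j) powr real_of_ereal (ereal p)) powr (1 / real_of_ereal (ereal p))
               \<le> \<bar>D\<bar> powr (1 / p) * rademacher_norm n x"
    by simp
qed

text \<open>
  The infimum \<open>D\<close> of the valid constants satisfies \<open>D \<le> D / 2 + 2 n0\<close>, whatever the number of vectors.
\<close>

lemma has_cotype_if_bad:
  assumes p: "2 \<le> p"
    and bad: "\<And>T (x :: nat \<Rightarrow> 'x::real_normed_vector) m. finite T \<Longrightarrow> card T = n0 \<Longrightarrow> 0 < m \<Longrightarrow>
      (\<And>j. j \<in> T \<Longrightarrow> m \<le> norm (x j) \<and> norm (x j) \<le> 2 * m) \<Longrightarrow>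
      \<exists>S\<subseteq>T. S \<noteq> {} \<and> 2 * (\<Sum>j\<in>S. norm (x j) powr p) \<le> rad_sq S x powr (p / 2)"
  shows "has_cotype TYPE('x) (ereal p)"
proof (rule has_cotypeI[OF p])
  fix n
  define V where "V = {D. 0 \<le> D \<and> cotype_const TYPE('x) p n D}"
  have V: "V \<noteq> {}" "bdd_below V"
    using cotype_const_trivial[of p n] p by (auto simp: V_def intro!: bdd_belowI[of _ 0] exI[of _ "real n"])
  have "Inf V < 4 * n0 + 1"
  proof (rule ccontr)
    assume *: "\<not> ?thesis"
    then obtain D where D: "D \<in> V" "D < Inf V + 1"
      using cInf_lessD[OF V(1), of "Inf V + 1"] by auto
    then have "D / 2 + 2 * n0 \<in> V"
      using cotype_const_improve[OF p bad] by (auto simp: V_def)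
    then have "Inf V \<le> D / 2 + 2 * n0" using V(2) by (rule cInf_lower)
    then show False using D * by simp
  qed
  then obtain D where D: "D \<in> V" "D < 4 * n0 + 1" using cInf_lessD[OF V(1)] by blast
  show "cotype_const TYPE('x) p n (4 * n0 + 1)"
    unfolding cotype_const_def
  proof (intro allI impI)
    fix S :: "nat set" and x :: "nat \<Rightarrow> 'x" assume "finite S \<and> card S \<le> n"
    then have "(\<Sum>j\<in>S. norm (x j) powr p) \<le> D * rad_sq S x powr (p / 2)"
      using D(1) by (auto simp: V_def cotype_const_def)
    also have "\<dots> \<le> (4 * n0 + 1) * rad_sq S x powr (p / 2)" using D(2) by (intro mult_right_mono) auto
    finally show "(\<Sum>j\<in>S. norm (x j) powr p) \<le> (4 * n0 + 1) * rad_sq S x powr (p / 2)" .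
  qed
qed

text \<open>
  This negates the hypothesis of the previous lemma.  There, the factor \<open>2\<close> becomes \<open>2\<^bsup>2/p\<^esup> \<le> 2\<close> on the
  level of \<open>rad_sq\<close>; together with the square of the norm bound \<open>2\<close> this gives the constant \<open>8\<close>.
\<close>

lemma upper_estimate_if_not_cotype:
  assumes p: "2 \<le> p" and nc: "\<not> has_cotype TYPE('x::real_normed_vector) (ereal p)"
  shows "\<exists>z :: nat \<Rightarrow> 'x. (\<forall>j<n. 1 \<le> norm (z j) \<and> norm (z j) \<le> 2) \<and>
           (\<forall>S\<subseteq>{..<n}. rad_sq S z \<le> 8 * real (card S) powr (2 / p))"
proof (rule ccontr)
  assume neg: "\<not> ?thesis"
  have "has_cotype TYPE('x) (ereal p)"
  proof (rule has_cotype_if_bad[OF p, where ?n0.0 = n])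
    fix T :: "nat set" and x :: "nat \<Rightarrow> 'x" and m :: real
    assume T: "finite T" "card T = n" and m: "0 < m"
      and x: "\<And>j. j \<in> T \<Longrightarrow> m \<le> norm (x j) \<and> norm (x j) \<le> 2 * m"
    obtain h where h: "bij_betw h {0..<n} T" using ex_bij_betw_nat_finite[OF T(1)] T(2) by blast
    define z where "z j = (1 / m) *\<^sub>R x (h j)" for j
    have hT: "h j \<in> T" if "j < n" for j using h that by (auto simp: bij_betw_def)
    have "\<forall>j<n. 1 \<le> norm (z j) \<and> norm (z j) \<le> 2"
      using x[OF hT] m by (simp add: z_def field_simps)
    with neg obtain S where S: "S \<subseteq> {..<n}" "8 * real (card S) powr (2 / p) < rad_sq S z"
      by (meson not_le)
    have Sfin: "finite S" using S(1) finite_subset by blast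
    have inj: "inj_on h S" using h S(1) unfolding bij_betw_def atLeast0LessThan by (blast intro: inj_on_subset)
    have radz: "rad_sq S z = (1 / m)\<^sup>2 * rad_sq (h ` S) x"
      unfolding z_def rad_sq_scaleR rad_sq_reindex[OF Sfin inj] by (simp add: comp_def)
    have "2 * (\<Sum>j\<in>h ` S. norm (x j) powr p) \<le> rad_sq (h ` S) x powr (p / 2)"
    proof -
      have "(\<Sum>j\<in>h ` S. norm (x j) powr p) \<le> (\<Sum>j\<in>h ` S. (2 * m) powr p)"
        using x hT S(1) p by (intro sum_mono powr_mono2) auto
      also have "\<dots> = card S * (2 * m) powr p" using inj by (simp add: card_image)
      finally have "2 * (\<Sum>j\<in>h ` S. norm (x j) powr p) \<le> 2 powr 1 * (card S * (2 * m) powr p)" by simp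
      also have "\<dots> \<le> 2 powr (p / 2) * (card S * (2 * m) powr p)"
        using p by (intro mult_right_mono powr_mono) auto
      also have "\<dots> = (8 * m\<^sup>2 * real (card S) powr (2 / p)) powr (p / 2)"
      proof -
        let ?c = "real (card S)"
        have "8 * m\<^sup>2 * ?c powr (2 / p) = 2 * ((2 * m)\<^sup>2 * ?c powr (2 / p))"
          by (simp add: power_mult_distrib)
        moreover have "(?c powr (2 / p)) powr (p / 2) = ?c" using p by (simp add: powr_powr)
        moreover have "((2 * m)\<^sup>2) powr (p / 2) = (2 * m) powr p"
          by (rule square_powr_half) (use m in simp)
        ultimately show ?thesis by (simp only: powr_mult mult.commute)
      qed
      also have "\<dots> \<le> rad_sq (h ` S) x powr (p / 2)"
        using S(2) p m unfolding radz by (intro powr_mono2) (auto simp: field_simps)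
      finally show ?thesis .
    qed
    moreover have "S \<noteq> {}" using S(2) by (auto simp: rad_sq_def sign_avg_def)
    ultimately show "\<exists>S\<subseteq>T. S \<noteq> {} \<and> 2 * (\<Sum>j\<in>S. norm (x j) powr p) \<le> rad_sq S x powr (p / 2)"
      using S(1) hT by (intro exI[of _ "h ` S"]) auto
  qed
  with nc show False by simp
qed

section \<open>Norming functionals\<close>

text \<open>
  The norming functionals of the Hahn-Banach theorem are found as minimal sublinear functionals.
\<close>

definition sublinear :: "('x::real_normed_vector \<Rightarrow> real) \<Rightarrow> bool" where
  "sublinear p \<longleftrightarrow> (\<forall>x y. p (x + y) \<le> p x + p y) \<and> (\<forall>c x. 0 \<le> c \<longrightarrow> p (c *\<^sub>R x) \<le> c * p x)"

lemma sublinear_add: "sublinear p \<Longrightarrow> p (x + y) \<le> p x + p y"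
  by (simp add: sublinear_def)

lemma sublinear_zero: "sublinear p \<Longrightarrow> p 0 = 0"
proof -
  assume p: "sublinear p"
  have "p (0 *\<^sub>R 0) \<le> 0 * p 0" using p unfolding sublinear_def by blast
  then show ?thesis using sublinear_add[OF p, of 0 0] by simp
qed

lemma sublinear_ge: "sublinear p \<Longrightarrow> - p (- x) \<le> p x"
  using sublinear_add[of p x "- x"] sublinear_zero[of p] by simp

lemma sublinear_scaleR:
  assumes p: "sublinear p" and c: "0 \<le> c"
  shows "p (c *\<^sub>R x) = c * p x"
proof (cases "c = 0")
  case False
  have "p (inverse c *\<^sub>R (c *\<^sub>R x)) \<le> inverse c * p (c *\<^sub>R x)"
    using p c unfolding sublinear_def by (meson inverse_nonnegative_iff_nonnegative)
  then have "c * p x \<le> p (c *\<^sub>R x)" using False c by (simp add: field_simps)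
  moreover have "p (c *\<^sub>R x) \<le> c * p x" using p c by (simp add: sublinear_def)
  ultimately show ?thesis by simp
qed (simp add: sublinear_zero[OF p])

text \<open>
  This is the largest sublinear functional below \<open>p\<close> whose value at \<open>- x\<close> is \<open>- p x\<close>; at a minimal
  \<open>p\<close> it must coincide with \<open>p\<close>, which forces \<open>p\<close> to be additive.
\<close>

definition along :: "('x::real_normed_vector \<Rightarrow> real) \<Rightarrow> 'x \<Rightarrow> 'x \<Rightarrow> real" where
  "along p x y = (INF t\<in>{0..}. p (y + t *\<^sub>R x) - t * p x)"

lemma along_le:
  assumes p: "sublinear p" and t: "0 \<le> t"
  shows "along p x y \<le> p (y + t *\<^sub>R x) - t * p x"
proof -
  have "- p (- y) \<le> p (y + s *\<^sub>R x) - s * p x" if "0 \<le> s" for s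
    using sublinear_add[OF p, of "y + s *\<^sub>R x" "- y"] sublinear_scaleR[OF p that, of x] by simp
  then have "bdd_below ((\<lambda>s. p (y + s *\<^sub>R x) - s * p x) ` {0..})"
    by (intro bdd_belowI2[of _ "- p (- y)"]) auto
  then show ?thesis unfolding along_def by (rule cINF_lower) (use t in simp)
qed

lemma le_along:
  assumes "\<And>t. 0 \<le> t \<Longrightarrow> c \<le> p (y + t *\<^sub>R x) - t * p x"
  shows "c \<le> along p x y"
  unfolding along_def using assms by (intro cINF_greatest) auto

lemma sublinear_along:
  assumes p: "sublinear p" shows "sublinear (along p x)"
  unfolding sublinear_def
proof (intro conjI allI impI)
  fix y z
  have "along p x (y + z) - (p (y + s *\<^sub>R x) - s * p x) \<le> along p x z" if s: "0 \<le> s" for s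
  proof (rule le_along)
    fix t :: real assume t: "0 \<le> t"
    have "along p x (y + z) \<le> p (y + z + (s + t) *\<^sub>R x) - (s + t) * p x"
      by (rule along_le[OF p]) (use s t in simp)
    also have "y + z + (s + t) *\<^sub>R x = (y + s *\<^sub>R x) + (z + t *\<^sub>R x)" by (simp add: algebra_simps)
    also have "p \<dots> \<le> p (y + s *\<^sub>R x) + p (z + t *\<^sub>R x)" by (rule sublinear_add[OF p])
    finally show "along p x (y + z) - (p (y + s *\<^sub>R x) - s * p x) \<le> p (z + t *\<^sub>R x) - t * p x"
      by (simp add: algebra_simps)
  qed
  then have "along p x (y + z) - along p x z \<le> along p x y"
    by (intro le_along) (force simp: algebra_simps)
  then show "along p x (y + z) \<le> along p x y + along p x z" by simp
next
  fix c :: real and y assume c: "0 \<le> c"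
  show "along p x (c *\<^sub>R y) \<le> c * along p x y"
  proof (cases "c = 0")
    case True
    then show ?thesis using along_le[OF p, of 0 x 0] by (simp add: sublinear_zero[OF p])
  next
    case False
    have "along p x (c *\<^sub>R y) / c \<le> along p x y"
    proof (rule le_along)
      fix t :: real assume t: "0 \<le> t"
      have "along p x (c *\<^sub>R y) \<le> p (c *\<^sub>R y + (c * t) *\<^sub>R x) - (c * t) * p x"
        by (rule along_le[OF p]) (use c t in simp)
      also have "c *\<^sub>R y + (c * t) *\<^sub>R x = c *\<^sub>R (y + t *\<^sub>R x)" by (simp add: algebra_simps)
      also have "p \<dots> = c * p (y + t *\<^sub>R x)" by (rule sublinear_scaleR[OF p c])
      finally show "along p x (c *\<^sub>R y) / c \<le> p (y + t *\<^sub>R x) - t * p x"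
        using False c by (simp add: field_simps)
    qed
    then show ?thesis using False c by (simp add: field_simps)
  qed
qed

text \<open>
  Zorn's lemma: a chain of sublinear functionals below \<open>p0\<close> is bounded from below pointwise, because
  \<open>p x \<ge> - p (- x) \<ge> - p0 (- x)\<close>, and its pointwise infimum is sublinear.
\<close>

lemma minimal_sublinear:
  fixes p0 :: "'x::real_normed_vector \<Rightarrow> real"
  assumes p0: "sublinear p0"
  obtains f where "sublinear f" "f \<le> p0" "\<And>p. sublinear p \<Longrightarrow> p \<le> f \<Longrightarrow> p = f"
proof -
  define A where "A = {p. sublinear p \<and> p \<le> p0}"
  have "\<exists>m\<in>A. \<forall>a\<in>A. a \<le> m \<longrightarrow> a = m"
  proof (rule predicate_Zorn)
    show "partial_order_on A (relation_of (\<lambda>x y. y \<le> x) A)"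
      by (auto simp: partial_order_on_def preorder_on_def refl_on_def trans_def antisym_def relation_of_def)
  next
    fix C assume C: "C \<in> Chains (relation_of (\<lambda>x y. y \<le> x) A)"
    then have CA: "p \<in> A" if "p \<in> C" for p using that by (auto simp: Chains_def relation_of_def)
    show "\<exists>u\<in>A. \<forall>a\<in>C. u \<le> a"
    proof (cases "C = {}")
      case True then show ?thesis using p0 by (auto simp: A_def)
    next
      case False
      define u where "u x = (INF p\<in>C. p x)" for x
      have bdd: "bdd_below ((\<lambda>p. p x) ` C)" for x
      proof (rule bdd_belowI2[of _ "- p0 (- x)"])
        fix p assume "p \<in> C"
        then have "sublinear p" "p (- x) \<le> p0 (- x)" using CA by (auto simp: A_def le_fun_def)
        then show "- p0 (- x) \<le> p x" using sublinear_ge[of p x] by simp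
      qed
      have u_le: "u x \<le> p x" if "p \<in> C" for p x
        unfolding u_def using bdd that by (rule cINF_lower)
      have le_u: "c \<le> u x" if "\<And>p. p \<in> C \<Longrightarrow> c \<le> p x" for c x
        unfolding u_def using False that by (intro cINF_greatest)
      have "sublinear u"
        unfolding sublinear_def
      proof (intro conjI allI impI)
        fix x y
        have "u (x + y) \<le> p x + p' y" if pp: "p \<in> C" "p' \<in> C" for p p'
        proof -
          obtain p'' where p'': "p'' \<in> C" "p'' \<le> p" "p'' \<le> p'"
            using C pp by (force simp: Chains_def relation_of_def)
          have "u (x + y) \<le> p'' (x + y)" by (rule u_le[OF p''(1)])
          also have "\<dots> \<le> p'' x + p'' y" using CA[OF p''(1)] by (simp add: A_def sublinear_add)
          also have "\<dots> \<le> p x + p' y" using p'' by (intro add_mono) (auto simp: le_fun_def)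
          finally show ?thesis .
        qed
        then have "u (x + y) - p x \<le> u y" if "p \<in> C" for p
          using that by (intro le_u) (force simp: algebra_simps)
        then have "u (x + y) - u y \<le> u x" by (intro le_u) (force simp: algebra_simps)
        then show "u (x + y) \<le> u x + u y" by simp
      next
        fix c :: real and x assume c: "0 \<le> c"
        have *: "u (c *\<^sub>R x) \<le> c * p x" if "p \<in> C" for p
          using u_le[OF that, of "c *\<^sub>R x"] CA[OF that] c by (simp add: A_def sublinear_scaleR)
        show "u (c *\<^sub>R x) \<le> c * u x"
        proof (cases "c = 0")
          case True then show ?thesis using * False by auto
        next
          case c0: False
          have "u (c *\<^sub>R x) / c \<le> u x" using * c c0 by (intro le_u) (simp add: field_simps)
          then show ?thesis using c c0 by (simp add: field_simps)
        qed
      qed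
      moreover have "u \<le> p0"
      proof -
        obtain p where p: "p \<in> C" using False by auto
        then have "u \<le> p" by (simp add: le_funI u_le)
        also have "p \<le> p0" using CA[OF p] by (simp add: A_def)
        finally show ?thesis .
      qed
      ultimately show ?thesis using u_le by (auto simp: A_def le_fun_def)
    qed
  qed
  then obtain f where f: "f \<in> A" "\<And>a. a \<in> A \<Longrightarrow> a \<le> f \<Longrightarrow> a = f" by blast
  show thesis
    by (rule that[of f]) (use f in \<open>auto simp: A_def intro: order_trans\<close>)
qed

text \<open>
  A minimal sublinear functional is linear.  Starting below \<open>along norm x0\<close> instead of the norm forces
  the value at \<open>- x0\<close> to be at most \<open>- norm x0\<close>.
\<close>

lemma real_norming_functional:
  fixes x0 :: "'x::real_normed_vector"
  obtains f :: "'x \<Rightarrow> real" where "linear f" "\<And>y. f y \<le> norm y" "f x0 = norm x0"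
proof -
  have nrm: "sublinear (norm :: 'x \<Rightarrow> real)" by (simp add: sublinear_def norm_triangle_ineq)
  obtain f where f: "sublinear f" "f \<le> along norm x0"
    and min: "\<And>p. sublinear p \<Longrightarrow> p \<le> f \<Longrightarrow> p = f"
    using minimal_sublinear[OF sublinear_along[OF nrm]] by blast
  have le: "f y \<le> norm y" for y
    using le_funD[OF f(2), of y] along_le[OF nrm, of 0 x0 y] by simp
  have "along f x \<le> f" for x
    using along_le[OF f(1), of 0 x] by (simp add: le_fun_def)
  \<comment> \<open>By minimality; evaluating \<open>along\<close> at \<open>t = 1\<close> then gives superadditivity.\<close>
  then have al: "along f x = f" for x using min sublinear_along[OF f(1)] by blast
  have "f y \<le> f (y + x) - f x" for x y
    using along_le[OF f(1), of 1 x y] by (simp add: al)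
  then have add: "f (y + x) = f y + f x" for x y
    using sublinear_add[OF f(1), of y x] by (simp add: order_antisym algebra_simps)
  have neg: "f (- x) = - f x" for x
    using add[of x "- x"] sublinear_zero[OF f(1)] by simp
  have "f (c *\<^sub>R x) = c * f x" for c x
  proof (cases "0 \<le> c")
    case False
    then show ?thesis using sublinear_scaleR[OF f(1), of "- c" x] neg[of "c *\<^sub>R x"] by simp
  qed (simp add: sublinear_scaleR[OF f(1)])
  then have lin: "linear f" using add by (intro linearI) auto
  have "f (- x0) \<le> - norm x0"
    using le_funD[OF f(2), of "- x0"] along_le[OF nrm, of 1 x0 "- x0"] by simp
  then have "f x0 = norm x0" using le[of x0] neg[of x0] by simp
  then show thesis using that lin le by blast
qed

text \<open>
  Real and imaginary parts for both kinds of scalars; over the reals the imaginary unit is replaced by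
  \<open>0\<close>, which allows a uniform treatment.
\<close>

lemma real_or_complex_coordinates:
  obtains i :: "'k::real_or_complex" and re im :: "'k \<Rightarrow> real"
  where "linear re" "linear im" "\<And>z. z = re z *\<^sub>R 1 + im z *\<^sub>R i"
    "\<And>z. \<bar>re z\<bar> \<le> norm z" "\<And>z. \<bar>im z\<bar> \<le> norm z" "norm i \<le> 1"
    "i = 0 \<and> im = (\<lambda>_. 0) \<or> i * i = - 1" "\<And>a b. re (a *\<^sub>R 1 + b *\<^sub>R i) = a"
proof (cases "\<forall>z::'k. \<exists>a. z = a *\<^sub>R 1")
  case True
  then obtain re where re: "\<And>z::'k. z = re z *\<^sub>R 1" by metis
  then have eq: "re (a *\<^sub>R 1) = a" for a
    by (metis scaleR_cancel_right zero_neq_one)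
  have "re (x + y) = re x + re y" "re (c *\<^sub>R x) = c * re x" for x y c
    using re eq scaleR_left_distrib[of "re x" "re y" "1::'k"] by (metis, metis scaleR_scaleR)
  then have "linear re" by (intro linearI) auto
  moreover have "\<bar>re z\<bar> \<le> norm z" for z using re[of z] by (metis norm_of_real of_real_def order_refl)
  ultimately show ?thesis
    using re eq by (intro that[of re "\<lambda>_. 0" 0]) (auto simp: linear_0 intro: linear_zero)
next
  case False
  then obtain i :: 'k where ii: "i * i = - 1"
    and rep: "\<And>z. \<exists>a b. z = a *\<^sub>R 1 + b *\<^sub>R i \<and> norm z = sqrt (a\<^sup>2 + b\<^sup>2)"
    using real_or_complex[where 'a='k] by blast
  have indep: "a = 0 \<and> b = 0" if "a *\<^sub>R 1 + b *\<^sub>R i = 0" for a b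
  proof -
    have "(a\<^sup>2 + b\<^sup>2) *\<^sub>R (1::'k) = (a *\<^sub>R 1 + b *\<^sub>R i) * (a *\<^sub>R 1 - b *\<^sub>R i)"
      by (simp add: ii algebra_simps power2_eq_square)
    then show ?thesis using that by (simp add: sum_power2_eq_zero_iff)
  qed
  have uniq: "a = c \<and> b = d" if "a *\<^sub>R 1 + b *\<^sub>R i = c *\<^sub>R 1 + d *\<^sub>R i" for a b c d
    using indep[of "a - c" "b - d"] that by (simp add: algebra_simps)
  obtain re im where rep: "\<And>z. z = re z *\<^sub>R 1 + im z *\<^sub>R i" and nrm: "\<And>z. norm z = sqrt ((re z)\<^sup>2 + (im z)\<^sup>2)"
    using rep by metis
  have re: "re (a *\<^sub>R 1 + b *\<^sub>R i) = a" and im: "im (a *\<^sub>R 1 + b *\<^sub>R i) = b" for a b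
    using uniq rep[of "a *\<^sub>R 1 + b *\<^sub>R i"] by metis+
  have sum: "x + y = (re x + re y) *\<^sub>R 1 + (im x + im y) *\<^sub>R i" for x y
  proof -
    have "(re x *\<^sub>R 1 + im x *\<^sub>R i) + (re y *\<^sub>R 1 + im y *\<^sub>R i) = (re x + re y) *\<^sub>R 1 + (im x + im y) *\<^sub>R i"
      by (simp add: scaleR_left_distrib)
    then show ?thesis by (simp only: rep[symmetric])
  qed
  have add: "re (x + y) = re x + re y" "im (x + y) = im x + im y" for x y
    using arg_cong[OF sum[of x y], of re] arg_cong[OF sum[of x y], of im] by (simp_all only: re im)
  have prod: "c *\<^sub>R x = (c * re x) *\<^sub>R 1 + (c * im x) *\<^sub>R i" for x c
  proof -
    have "c *\<^sub>R (re x *\<^sub>R 1 + im x *\<^sub>R i) = (c * re x) *\<^sub>R 1 + (c * im x) *\<^sub>R i"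
      by (simp add: scaleR_right_distrib)
    then show ?thesis by (simp only: rep[symmetric])
  qed
  have scale: "re (c *\<^sub>R x) = c * re x" "im (c *\<^sub>R x) = c * im x" for x c
    using arg_cong[OF prod[of c x], of re] arg_cong[OF prod[of c x], of im] by (simp_all only: re im)
  have "norm i * norm i = 1" by (metis ii norm_minus_cancel norm_mult norm_one)
  then have "norm i = 1" by (metis norm_ge_zero abs_of_nonneg real_sqrt_abs2 real_sqrt_one)
  moreover have "\<bar>re z\<bar> \<le> norm z" "\<bar>im z\<bar> \<le> norm z" for z unfolding nrm by (auto intro: real_le_rsqrt)
  ultimately show ?thesis
    using rep re ii add scale by (intro that[of re im i]) (auto intro!: linearI)
qed

instance real_or_complex \<subseteq> banach
proof
  fix X :: "nat \<Rightarrow> 'a" assume X: "Cauchy X"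
  obtain i :: 'a and re im where lin: "linear re" "linear im" and rep: "\<And>z. z = re z *\<^sub>R 1 + im z *\<^sub>R i"
    and le: "\<And>z. \<bar>re z\<bar> \<le> norm z" "\<And>z. \<bar>im z\<bar> \<le> norm z"
    by (rule real_or_complex_coordinates[where 'k='a]) blast
  have "convergent (\<lambda>n. g (X n))" if g: "linear g" "\<And>z. \<bar>g z\<bar> \<le> norm z" for g :: "'a \<Rightarrow> real"
  proof -
    have "bounded_linear g"
      using g by (intro bounded_linear_intro[of g 1]) (auto simp: linear_add linear_cmul)
    then show ?thesis using bounded_linear.Cauchy[OF _ X] real_Cauchy_convergent by blast
  qed
  then have "convergent (\<lambda>n. re (X n))" "convergent (\<lambda>n. im (X n))" using lin le by blast+
  then obtain a b where "(\<lambda>n. re (X n)) \<longlonglongrightarrow> a" "(\<lambda>n. im (X n)) \<longlonglongrightarrow> b"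
    by (auto simp: convergent_def)
  then have "(\<lambda>n. re (X n) *\<^sub>R 1 + im (X n) *\<^sub>R i) \<longlonglongrightarrow> a *\<^sub>R 1 + b *\<^sub>R i"
    by (intro tendsto_intros)
  then show "convergent X" using rep by (auto simp: convergent_def)
qed

lemma vector_space_mult: "vector_space ((*) :: 'k::field \<Rightarrow> 'k \<Rightarrow> 'k)"
  by unfold_locales (auto simp: algebra_simps)

text \<open>
  The functional \<open>\<phi> x = f x - f (i x) i\<close> is linear over the scalars and has the real functional \<open>f\<close> as
  its real part.
\<close>

lemma dual_ball_norming:
  fixes scal :: "'k::real_or_complex \<Rightarrow> 'x::banach \<Rightarrow> 'x"
  assumes X: "banach_space_over scal"
  obtains \<phi> where "\<phi> \<in> dual_ball scal" "norm (\<phi> x0) = norm x0"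
proof -
  interpret banach_space_over scal by fact
  obtain f :: "'x \<Rightarrow> real" where f: "linear f" "\<And>y. f y \<le> norm y" "f x0 = norm x0"
    by (rule real_norming_functional[of x0]) blast
  obtain i :: 'k and re im where lin: "linear re" "linear im" and rep: "\<And>z. z = re z *\<^sub>R 1 + im z *\<^sub>R i"
    and le: "\<And>z. \<bar>re z\<bar> \<le> norm z"
    and i: "i = 0 \<and> im = (\<lambda>_. 0) \<or> i * i = - 1" and re: "\<And>a b. re (a *\<^sub>R 1 + b *\<^sub>R i) = a"
    by (rule real_or_complex_coordinates[where 'k='k]) blast
  define \<phi> where "\<phi> x = f x *\<^sub>R 1 + (- f (scal i x)) *\<^sub>R i" for x
  have add: "\<phi> (x + y) = \<phi> x + \<phi> y" for x y
    by (simp add: \<phi>_def linear_add[OF f(1)] scale_right_distrib algebra_simps)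
  have scaleR: "r *\<^sub>R x = scal (r *\<^sub>R 1) x" for r x
    using scal_of_real[of r x] by (simp add: of_real_def)
  have f_scal: "f (scal (a *\<^sub>R 1) x) = a * f x" for a x
    unfolding scaleR[symmetric] by (simp add: linear_cmul[OF f(1)])
  have mult: "\<phi> (scal c x) = c * \<phi> x" for c x
  proof -
    define a b where "a = re c" and "b = im c"
    have c: "c = a *\<^sub>R 1 + b *\<^sub>R i" unfolding a_def b_def by (rule rep)
    have 1: "f (scal c x) = a * f x + b * f (scal i x)"
    proof -
      have "scal c x = scal (a *\<^sub>R 1) x + scal (b *\<^sub>R 1) (scal i x)"
        by (simp add: c scale_left_distrib)
      then show ?thesis by (simp only: linear_add[OF f(1)] f_scal)
    qed
    show ?thesis
    proof (cases "i = 0")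
      case True then show ?thesis using 1 by (simp add: \<phi>_def c linear_0[OF f(1)])
    next
      case False
      then have ii: "i * i = - 1" using i by blast
      have "f (scal i (scal c x)) = a * f (scal i x) - b * f x"
      proof -
        have "i * c = a *\<^sub>R i + (- b) *\<^sub>R 1" by (simp add: c algebra_simps ii)
        then have "scal i (scal c x) = scal (a *\<^sub>R 1) (scal i x) + scal ((- b) *\<^sub>R 1) x"
          by (simp add: scale_left_distrib[symmetric] del: scaleR_minus_left)
        then show ?thesis by (simp only: linear_add[OF f(1)] f_scal)
      qed
      then have "\<phi> (scal c x) = (a * f x + b * f (scal i x)) *\<^sub>R 1 + (- (a * f (scal i x) - b * f x)) *\<^sub>R i"
        by (simp only: \<phi>_def 1)
      also have "\<dots> = (a *\<^sub>R 1 + b *\<^sub>R i) * \<phi> x" by (simp add: \<phi>_def algebra_simps ii)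
      finally show ?thesis by (simp only: c[symmetric])
    qed
  qed
  have norm_le: "norm (\<phi> x) \<le> norm x" for x
  proof (cases "\<phi> x = 0")
    case False
    \<comment> \<open>Rotate \<open>x\<close> so that the value of the functional becomes its real part.\<close>
    define c where "c = of_real (norm (\<phi> x)) / \<phi> x"
    have "\<phi> (scal c x) = of_real (norm (\<phi> x))" using False by (simp add: mult c_def)
    then have "\<phi> (scal c x) = norm (\<phi> x) *\<^sub>R 1" by (simp only: of_real_def)
    then have "f (scal c x) = re (norm (\<phi> x) *\<^sub>R 1 + 0 *\<^sub>R i)"
      using re[of "f (scal c x)" "- f (scal i (scal c x))"] by (simp only: \<phi>_def) simp
    then have "norm (\<phi> x) = f (scal c x)" by (simp only: re)
    also have "\<dots> \<le> norm (scal c x)" by (rule f)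
    also have "\<dots> = norm x" using False by (simp add: norm_scal c_def norm_divide)
    finally show ?thesis .
  qed simp
  have bl: "bounded_linear \<phi>"
    by (rule bounded_linear_intro[of _ 1]) (simp_all add: add scaleR[of _ "_::'x"] mult norm_le)
  have "onorm \<phi> \<le> 1" using norm_le by (intro onorm_bound) auto
  moreover have "Vector_Spaces.linear scal (*) \<phi>"
    unfolding Vector_Spaces.linear_iff using add mult vector_space_mult vector_space_axioms by blast
  ultimately have "\<phi> \<in> dual_ball scal" using bl by (simp add: dual_ball_def)
  moreover have "norm (\<phi> x0) = norm x0"
  proof (rule antisym[OF norm_le])
    have "norm x0 = re (\<phi> x0)" by (simp only: \<phi>_def re f)
    then show "norm x0 \<le> norm (\<phi> x0)" using le[of "\<phi> x0"] by simp
  qed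
  ultimately show thesis by (rule that)
qed

lemma dual_ballD:
  assumes "\<phi> \<in> dual_ball scal"
  shows "Vector_Spaces.linear scal (*) \<phi>" "bounded_linear \<phi>" "norm (\<phi> x) \<le> norm x"
proof -
  show *: "Vector_Spaces.linear scal (*) \<phi>" "bounded_linear \<phi>" using assms by (auto simp: dual_ball_def)
  have "norm (\<phi> x) \<le> onorm \<phi> * norm x" by (rule onorm[OF *(2)])
  also have "\<dots> \<le> 1 * norm x" using assms by (intro mult_right_mono) (auto simp: dual_ball_def)
  finally show "norm (\<phi> x) \<le> norm x" by simp
qed

text \<open>
  The moduli of the real parts of the values add up to the real part of the value at a suitable signed
  sum; the same holds for the imaginary parts, whence the factor \<open>2\<close>.
\<close>

lemma sum_norm_le_signs:
  fixes \<phi> :: "'x::real_normed_vector \<Rightarrow> 'k::real_or_complex"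
  assumes \<phi>: "bounded_linear \<phi>" "\<And>x. norm (\<phi> x) \<le> norm x"
    and C: "\<And>\<epsilon>. (\<forall>j\<in>S. \<epsilon> j \<in> {- 1, 1}) \<Longrightarrow> norm (\<Sum>j\<in>S. \<epsilon> j *\<^sub>R u j) \<le> C"
  shows "(\<Sum>j\<in>S. norm (\<phi> (u j))) \<le> 2 * C"
proof -
  obtain i :: 'k and re im where lin: "linear re" "linear im" and rep: "\<And>z. z = re z *\<^sub>R 1 + im z *\<^sub>R i"
    and le: "\<And>z. \<bar>re z\<bar> \<le> norm z" "\<And>z. \<bar>im z\<bar> \<le> norm z" and i: "norm i \<le> 1"
    by (rule real_or_complex_coordinates[where 'k='k]) blast
  have part: "(\<Sum>j\<in>S. \<bar>g (\<phi> (u j))\<bar>) \<le> C" if g: "linear g" "\<And>z. \<bar>g z\<bar> \<le> norm z" for g :: "'k \<Rightarrow> real"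
  proof -
    let ?\<epsilon> = "\<lambda>j. if 0 \<le> g (\<phi> (u j)) then 1 else - 1 :: real"
    have "(\<Sum>j\<in>S. \<bar>g (\<phi> (u j))\<bar>) = (\<Sum>j\<in>S. ?\<epsilon> j * g (\<phi> (u j)))" by (intro sum.cong) auto
    also have "\<dots> = g (\<phi> (\<Sum>j\<in>S. ?\<epsilon> j *\<^sub>R u j))"
      using g(1) \<phi>(1) by (simp add: linear_sum linear_cmul bounded_linear.linear)
    also have "\<dots> \<le> norm (\<Sum>j\<in>S. ?\<epsilon> j *\<^sub>R u j)"
      using g(2) \<phi>(2) by (meson abs_le_D1 order_trans)
    also have "\<dots> \<le> C" by (rule C) simp
    finally show ?thesis .
  qed
  have "norm z \<le> \<bar>re z\<bar> + \<bar>im z\<bar>" for z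
  proof -
    have "norm z \<le> norm (re z *\<^sub>R (1::'k)) + norm (im z *\<^sub>R i)"
      by (subst rep[of z]) (rule norm_triangle_ineq)
    also have "\<dots> \<le> \<bar>re z\<bar> + \<bar>im z\<bar>" using i by (simp add: mult_left_le)
    finally show ?thesis .
  qed
  then have "(\<Sum>j\<in>S. norm (\<phi> (u j))) \<le> (\<Sum>j\<in>S. \<bar>re (\<phi> (u j))\<bar> + \<bar>im (\<phi> (u j))\<bar>)" by (rule sum_mono)
  also have "\<dots> \<le> 2 * C" using part[OF lin(1) le(1)] part[OF lin(2) le(2)] by (simp add: sum.distrib)
  finally show ?thesis .
qed

section \<open>Unconditional sequences by Ramsey's theorem\<close>

text \<open>
  Combinations of \<open>m\<close> vectors with coefficients \<open>-1\<close>, \<open>0\<close>, \<open>1\<close> have almost the same norm at all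
  increasing positions.  An additive error is harmless since the estimates of interest have
  right-hand sides of order at least \<open>1\<close>.
\<close>

definition spreading :: "nat \<Rightarrow> nat \<Rightarrow> (nat \<Rightarrow> 'x::real_normed_vector) \<Rightarrow> bool" where
  "spreading m L y \<longleftrightarrow>
     (\<forall>b i i'. (\<forall>l<m. b l \<in> {- 1, 0, 1}) \<longrightarrow>
        strict_mono_on {..<m} i \<longrightarrow> i ` {..<m} \<subseteq> {..<L} \<longrightarrow>
        strict_mono_on {..<m} i' \<longrightarrow> i' ` {..<m} \<subseteq> {..<L} \<longrightarrow>
        \<bar>norm (\<Sum>l<m. b l *\<^sub>R y (i l)) - norm (\<Sum>l<m. b l *\<^sub>R y (i' l))\<bar> \<le> 1 / 4)"

lemma sorted_list_of_set_strict_mono_image: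
  fixes g :: "nat \<Rightarrow> nat"
  assumes "strict_mono_on {..<m} g"
  shows "sorted_list_of_set (g ` {..<m}) = map g [0..<m]"
proof -
  have "sorted_wrt (<) (map g [0..<m])"
    using assms by (auto simp: sorted_wrt_iff_nth_less strict_mono_on_def)
  then have "sorted_list_of_set (set (map g [0..<m])) = map g [0..<m]"
    using sorted_list_of_set.idem_if_sorted_distinct strict_sorted_iff by blast
  then show ?thesis by (simp add: atLeast0LessThan)
qed

lemma strict_mono_enumeration:
  fixes H :: "nat set"
  assumes "finite H" "card H = L"
  obtains h where "strict_mono_on {..<L} h" "h ` {..<L} = H"
proof
  let ?h = "\<lambda>l. sorted_list_of_set H ! l"
  show "strict_mono_on {..<L} ?h"
    using assms sorted_wrt_nth_less[OF strict_sorted_list_of_set[of H]]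
    by (auto simp: strict_mono_on_def)
  show "?h ` {..<L} = H"
    using assms set_sorted_list_of_set[OF assms(1)] nth_image[of L "sorted_list_of_set H"]
    by (simp add: atLeast0LessThan)
qed

text \<open>
  An \<open>m\<close>-element set of positions is coloured by the norms of all these combinations, rounded to
  multiples of \<open>1/4\<close>; there are finitely many colours, so Ramsey's theorem applies.
\<close>

lemma spreading_subsequence:
  obtains N where "\<And>z :: nat \<Rightarrow> 'x::real_normed_vector. (\<And>j. j < N \<Longrightarrow> norm (z j) \<le> 2) \<Longrightarrow>
    \<exists>h. strict_mono_on {..<L} h \<and> h ` {..<L} \<subseteq> {..<N} \<and> spreading m L (z \<circ> h)"
proof -
  define B where "B = {..<m} \<rightarrow>\<^sub>E {- 1, 0, 1::real}"
  define Cols where "Cols = B \<rightarrow>\<^sub>E {..8 * m}"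
  have "finite Cols" unfolding Cols_def B_def by (intro finite_PiE) auto
  then obtain e where e: "bij_betw e Cols {0..<card Cols}"
    using ex_bij_betw_finite_nat by blast
  obtain N :: nat where N: "partn_lst {..<N} (replicate (card Cols) L) m"
    using ramsey_full[of "replicate (card Cols) L" m] by blast
  have "\<exists>h. strict_mono_on {..<L} h \<and> h ` {..<L} \<subseteq> {..<N} \<and> spreading m L (z \<circ> h)"
    if z: "\<And>j. j < N \<Longrightarrow> norm (z j) \<le> 2" for z :: "nat \<Rightarrow> 'x"
  proof -
    define v where "v T b = norm (\<Sum>l<m. b l *\<^sub>R z (sorted_list_of_set T ! l))" for T b
    define col where "col T = restrict (\<lambda>b. nat \<lfloor>4 * v T b\<rfloor>) B" for T
    have "col T \<in> Cols" if T: "T \<in> nsets {..<N} m" for T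
    proof -
      have "nat \<lfloor>4 * v T b\<rfloor> \<le> 8 * m" if b: "b \<in> B" for b
      proof -
        have "norm (b l *\<^sub>R z (sorted_list_of_set T ! l)) \<le> 2" if l: "l < m" for l
        proof -
          have "sorted_list_of_set T ! l \<in> T"
            using T l nth_mem[of l "sorted_list_of_set T"] by (simp add: nsets_def)
          then have "norm (z (sorted_list_of_set T ! l)) \<le> 2" using T by (intro z) (auto simp: nsets_def)
          moreover have "b l \<in> {- 1, 0, 1}" using b l by (auto simp: B_def)
          ultimately show ?thesis by auto
        qed
        then have "v T b \<le> (\<Sum>l<m. 2)" unfolding v_def by (intro sum_norm_le) auto
        then have "4 * v T b \<le> real (8 * m)" by simp
        then show ?thesis by linarith
      qed
      then show ?thesis by (auto simp: col_def Cols_def)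
    qed
    then have "(\<lambda>T. e (col T)) \<in> nsets {..<N} m \<rightarrow> {..<card Cols}"
      using e by (auto simp: bij_betw_def)
    then obtain c H where H: "H \<in> nsets {..<N} L" and mono: "(\<lambda>T. e (col T)) ` nsets H m \<subseteq> {c}"
      using N unfolding partn_lst_def monochromatic_def by fastforce
    have same: "col T = col T'" if "T \<in> nsets H m" "T' \<in> nsets H m" for T T'
    proof -
      have "nsets H m \<subseteq> nsets {..<N} m" using H by (intro nsets_mono) (auto simp: nsets_def)
      then have "col T \<in> Cols" "col T' \<in> Cols" using that \<open>\<And>T. T \<in> nsets {..<N} m \<Longrightarrow> col T \<in> Cols\<close> by auto
      moreover have "e (col T) = e (col T')" using mono that by auto
      ultimately show ?thesis using e by (auto simp: bij_betw_def inj_on_def)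
    qed
    obtain h where h: "strict_mono_on {..<L} h" "h ` {..<L} = H"
      using H strict_mono_enumeration[of H L] by (auto simp: nsets_def)
    have "spreading m L (z \<circ> h)"
      unfolding spreading_def
    proof (intro allI impI)
      fix b :: "nat \<Rightarrow> real" and i i' :: "nat \<Rightarrow> nat"
      assume b: "\<forall>l<m. b l \<in> {- 1, 0, 1}"
        and i: "strict_mono_on {..<m} i" "i ` {..<m} \<subseteq> {..<L}"
        and i': "strict_mono_on {..<m} i'" "i' ` {..<m} \<subseteq> {..<L}"
      let ?b = "restrict b {..<m}"
      have bB: "?b \<in> B" using b by (auto simp: B_def)
      have T: "(h \<circ> j) ` {..<m} \<in> nsets H m" "v ((h \<circ> j) ` {..<m}) ?b = norm (\<Sum>l<m. b l *\<^sub>R (z \<circ> h) (j l))"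
        if j: "strict_mono_on {..<m} j" "j ` {..<m} \<subseteq> {..<L}" for j
      proof -
        have sm: "strict_mono_on {..<m} (h \<circ> j)"
          using j h(1) by (auto simp: strict_mono_on_def image_subset_iff)
        have "card ((h \<circ> j) ` {..<m}) = m"
          unfolding card_image[OF strict_mono_on_imp_inj_on[OF sm]] by simp
        moreover have "(h \<circ> j) ` {..<m} \<subseteq> H" using j h(2) by auto
        ultimately show "(h \<circ> j) ` {..<m} \<in> nsets H m" by (simp add: nsets_def)
        show "v ((h \<circ> j) ` {..<m}) ?b = norm (\<Sum>l<m. b l *\<^sub>R (z \<circ> h) (j l))"
          unfolding v_def sorted_list_of_set_strict_mono_image[OF sm] by (auto intro!: arg_cong[where f=norm] sum.cong)
      qed
      have "nat \<lfloor>4 * v ((h \<circ> i) ` {..<m}) ?b\<rfloor> = nat \<lfloor>4 * v ((h \<circ> i') ` {..<m}) ?b\<rfloor>"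
        using fun_cong[OF same[OF T(1)[OF i] T(1)[OF i']], of ?b] bB by (simp add: col_def)
      moreover have "0 \<le> v T ?b" for T by (simp add: v_def)
      ultimately have "\<lfloor>4 * v ((h \<circ> i) ` {..<m}) ?b\<rfloor> = \<lfloor>4 * v ((h \<circ> i') ` {..<m}) ?b\<rfloor>"
        by (simp add: eq_nat_nat_iff)
      then have "\<bar>v ((h \<circ> i) ` {..<m}) ?b - v ((h \<circ> i') ` {..<m}) ?b\<bar> \<le> 1 / 4" by linarith
      then show "\<bar>norm (\<Sum>l<m. b l *\<^sub>R (z \<circ> h) (i l)) - norm (\<Sum>l<m. b l *\<^sub>R (z \<circ> h) (i' l))\<bar> \<le> 1 / 4"
        by (simp only: T(2)[OF i] T(2)[OF i'])
    qed
    then show ?thesis using h H by (intro exI[of _ h]) (auto simp: nsets_def)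
  qed
  then show thesis by (rule that)
qed

text \<open>
  Combinations of at most \<open>m\<close> vectors are padded with zero coefficients at the \<open>m\<close> additional
  positions from \<open>L\<close> on.
\<close>

lemma spreading_initial:
  assumes y: "spreading m (L + m) y" and s: "s \<le> m" and b: "\<And>l. l < s \<Longrightarrow> b l \<in> {- 1, 1}"
    and i: "strict_mono_on {..<s} i" "\<And>l. l < s \<Longrightarrow> i l < L"
    and i': "strict_mono_on {..<s} i'" "\<And>l. l < s \<Longrightarrow> i' l < L"
  shows "norm (\<Sum>l<s. b l *\<^sub>R y (i l)) \<le> norm (\<Sum>l<s. b l *\<^sub>R y (i' l)) + 1 / 4"
proof -
  define ext where "ext j l = (if l < s then j l else L + l)" for j :: "nat \<Rightarrow> nat" and l
  define b' where "b' l = (if l < s then b l else 0)" for l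
  have ext: "strict_mono_on {..<m} (ext j)" "ext j ` {..<m} \<subseteq> {..<L + m}"
    if "strict_mono_on {..<s} j" "\<And>l. l < s \<Longrightarrow> j l < L" for j
    using that by (auto simp: strict_mono_on_def ext_def intro: less_trans trans_less_add1 less_le_trans)
  have sum: "(\<Sum>l<m. b' l *\<^sub>R y (ext j l)) = (\<Sum>l<s. b l *\<^sub>R y (j l))" for j
    using s by (intro sum.mono_neutral_cong_right) (auto simp: b'_def ext_def)
  have "\<forall>l<m. b' l \<in> {- 1, 0, 1}" using b by (auto simp: b'_def)
  then have "\<bar>norm (\<Sum>l<m. b' l *\<^sub>R y (ext i l)) - norm (\<Sum>l<m. b' l *\<^sub>R y (ext i' l))\<bar> \<le> 1 / 4"
    using y ext[OF i] ext[OF i'] unfolding spreading_def by blast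
  then show ?thesis unfolding sum by linarith
qed

lemma rad_sq_functional_le:
  fixes f :: "'x::real_normed_vector \<Rightarrow> real"
  assumes "linear f" "\<And>x. \<bar>f x\<bar> \<le> norm x" "finite S"
  shows "(\<Sum>j\<in>S. (f (y j))\<^sup>2) \<le> rad_sq S y"
proof -
  have "(\<Sum>j\<in>S. (f (y j))\<^sup>2) = rad_sq S (\<lambda>j. f (y j))" using assms(3) by (simp add: rad_sq_real)
  also have "\<dots> \<le> rad_sq S y"
    unfolding rad_sq_def
  proof (rule sign_avg_mono)
    fix \<epsilon> :: "_ \<Rightarrow> real"
    have "(\<Sum>j\<in>S. \<epsilon> j *\<^sub>R f (y j)) = f (\<Sum>j\<in>S. \<epsilon> j *\<^sub>R y j)"
      using assms(1) by (simp add: linear_sum linear_cmul)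
    then show "(norm (\<Sum>j\<in>S. \<epsilon> j *\<^sub>R f (y j)))\<^sup>2 \<le> (norm (\<Sum>j\<in>S. \<epsilon> j *\<^sub>R y j))\<^sup>2"
      using assms(2)[of "\<Sum>j\<in>S. \<epsilon> j *\<^sub>R y j"] by (simp only: power_mono real_norm_def norm_ge_zero abs_ge_zero)
  qed
  finally show ?thesis .
qed

lemma sum_pairs: "(\<Sum>l<2 * c. g l) = (\<Sum>l<c. g (2 * l) + g (2 * l + 1))"
  for g :: "nat \<Rightarrow> 'a::comm_monoid_add"
  by (induction c) (simp_all add: add.assoc)

text \<open>
  The sequence is cut into blocks of length \<open>R + 1\<close>.  The length \<open>R\<close> is large enough for the averaging
  argument in \<open>good_signs_suppression\<close>, and \<open>L\<close> for \<open>norm_u_ge\<close>.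
\<close>

locale spreading_sequence =
  fixes y :: "nat \<Rightarrow> 'x::real_normed_vector" and p :: real and k R L :: nat
  assumes p: "2 < p" and k: "1 \<le> k"
    and R: "8 * k \<le> R" and L: "2 * k * (R + 1) \<le> L" "32 < real L powr (1 - 2 / p)"
    and spread: "spreading (2 * k) (L + 2 * k) y"
    and norm_y: "\<And>j. j < L \<Longrightarrow> 1 \<le> norm (y j)" "\<And>j. j < L \<Longrightarrow> norm (y j) \<le> 2"
    and rad_y: "\<And>S. S \<subseteq> {..<L} \<Longrightarrow> rad_sq S y \<le> 8 * real (card S) powr (2 / p)"
begin

definition u :: "nat \<Rightarrow> 'x" where
  "u l = y (l * (R + 1)) - y (l * (R + 1) + 1)"

lemma R_pos: "1 \<le> R" using R k by linarith

lemma block_less: "l < 2 * k \<Longrightarrow> t \<le> R \<Longrightarrow> l * (R + 1) + t < L"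
proof -
  assume l: "l < 2 * k" and t: "t \<le> R"
  have "l * (R + 1) + t < (l + 1) * (R + 1)" using t by simp
  also have "\<dots> \<le> 2 * k * (R + 1)" using l by (intro mult_right_mono) auto
  finally show ?thesis using L(1) by linarith
qed

lemma block_mono: "l < l' \<Longrightarrow> t \<le> R \<Longrightarrow> l * (R + 1) + t < l' * (R + 1) + t'"
proof -
  assume l: "l < l'" and t: "t \<le> R"
  have "l * (R + 1) + t < (l + 1) * (R + 1)" using t by simp
  also have "\<dots> \<le> l' * (R + 1)" using l by (intro mult_right_mono) auto
  finally show ?thesis by linarith
qed

lemma block_selection:
  assumes "\<And>l. \<tau> l \<le> R" "s \<le> 2 * k"
  shows "strict_mono_on {..<s} (\<lambda>l. l * (R + 1) + \<tau> l)" "\<And>l. l < s \<Longrightarrow> l * (R + 1) + \<tau> l < L"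
proof -
  show "strict_mono_on {..<s} (\<lambda>l. l * (R + 1) + \<tau> l)"
    by (rule strict_mono_onI, rule block_mono) (simp_all only: assms)
  show "\<And>l. l < s \<Longrightarrow> l * (R + 1) + \<tau> l < L"
    using assms(2) by (intro block_less assms(1)) auto
qed

lemma one_le_powr: "1 \<le> s \<Longrightarrow> 1 \<le> real s powr (1 / p)"
  using p by (intro ge_one_powr_ge_zero) auto

text \<open>
  Some choice of signs is at least as good as the average; by the spreading property it is good at all
  positions.
\<close>

lemma good_signs:
  assumes s: "1 \<le> s" "s \<le> 2 * k"
  obtains \<delta> :: "nat \<Rightarrow> real" where "\<And>l. l < s \<Longrightarrow> \<delta> l \<in> {- 1, 1}"
    "\<And>i. strict_mono_on {..<s} i \<Longrightarrow> (\<And>l. l < s \<Longrightarrow> i l < L) \<Longrightarrow>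
       norm (\<Sum>l<s. \<delta> l *\<^sub>R y (i l)) \<le> 3 * real s powr (1 / p) + 1 / 4"
proof -
  have sL: "s \<le> L" using s block_less[of "s - 1" 0] by (cases s) auto
  then have "rad_sq {..<s} y \<le> 8 * real s powr (2 / p)" using rad_y[of "{..<s}"] by simp
  then obtain \<delta> where \<delta>: "\<delta> \<in> {..<s} \<rightarrow>\<^sub>E {- 1, 1}"
    "(norm (\<Sum>l<s. \<delta> l *\<^sub>R y l))\<^sup>2 \<le> 8 * real s powr (2 / p)"
    using sign_avg_le_ex[of "{..<s}"] unfolding rad_sq_def by blast
  have "8 * real s powr (2 / p) \<le> (3 * real s powr (1 / p))\<^sup>2"
    using s by (simp add: power_mult_distrib powr_power)
  with \<delta>(2) have "(norm (\<Sum>l<s. \<delta> l *\<^sub>R y l))\<^sup>2 \<le> (3 * real s powr (1 / p))\<^sup>2" by linarith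
  then have le: "norm (\<Sum>l<s. \<delta> l *\<^sub>R y l) \<le> 3 * real s powr (1 / p)"
    by (rule power2_le_imp_le) simp
  have \<delta>1: "\<delta> l \<in> {- 1, 1}" if "l < s" for l using PiE_mem[OF \<delta>(1), of l] that by simp
  show thesis
  proof (rule that[OF \<delta>1])
    fix i :: "nat \<Rightarrow> nat" assume i: "strict_mono_on {..<s} i" "\<And>l. l < s \<Longrightarrow> i l < L"
    have "norm (\<Sum>l<s. \<delta> l *\<^sub>R y (i l)) \<le> norm (\<Sum>l<s. \<delta> l *\<^sub>R y l) + 1 / 4"
      using spreading_initial[OF spread s(2) \<delta>1 i, of "\<lambda>l. l"] sL by (auto simp: strict_mono_on_def)
    then show "norm (\<Sum>l<s. \<delta> l *\<^sub>R y (i l)) \<le> 3 * real s powr (1 / p) + 1 / 4" using le by linarith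
  qed
qed

text \<open>
  Let \<open>\<delta>\<close> be the good signs.  For \<open>l \<notin> A\<close> replace the difference \<open>u l\<close> of the first two vectors of the
  block \<open>l\<close> by that of the vectors number \<open>t\<close> and \<open>t + 1\<close>.  The resulting sums have small norm for every
  \<open>t\<close>, and in their average over \<open>t < R\<close> the terms with \<open>l \<notin> A\<close> telescope and become negligible.
\<close>

lemma good_signs_suppression:
  assumes s: "1 \<le> s" "s \<le> 2 * k"
  obtains \<delta> :: "nat \<Rightarrow> real" where "\<And>l. l < s \<Longrightarrow> \<delta> l \<in> {- 1, 1}"
    "\<And>A. A \<subseteq> {..<s} \<Longrightarrow> norm (\<Sum>l\<in>A. \<delta> l *\<^sub>R u l) \<le> 8 * real s powr (1 / p)"
proof -
  obtain \<delta> :: "nat \<Rightarrow> real" where \<delta>: "\<And>l. l < s \<Longrightarrow> \<delta> l \<in> {- 1, 1}"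
    and le: "\<And>i. strict_mono_on {..<s} i \<Longrightarrow> (\<And>l. l < s \<Longrightarrow> i l < L) \<Longrightarrow>
       norm (\<Sum>l<s. \<delta> l *\<^sub>R y (i l)) \<le> 3 * real s powr (1 / p) + 1 / 4"
    by (rule good_signs[OF s]) blast
  have "norm (\<Sum>l\<in>A. \<delta> l *\<^sub>R u l) \<le> 8 * real s powr (1 / p)" if A: "A \<subseteq> {..<s}" for A
  proof -
    let ?d = "\<lambda>l t. y (l * (R + 1) + t) - y (l * (R + 1) + Suc t)"
    let ?t = "\<lambda>t l. if l \<in> A then 0 else t"
    let ?B = "{..<s} - A"
    have split: "(\<Sum>l<s. g l) = (\<Sum>l\<in>A. g l) + (\<Sum>l\<in>?B. g l)" for g :: "nat \<Rightarrow> 'x"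
      using sum.subset_diff[OF A, of g] by (simp add: add.commute)
    have v: "norm (\<Sum>l<s. \<delta> l *\<^sub>R ?d l (?t t l)) \<le> 7 * real s powr (1 / p)" if t: "t < R" for t
    proof -
      let ?a = "\<Sum>l<s. \<delta> l *\<^sub>R y (l * (R + 1) + ?t t l)"
        and ?b = "\<Sum>l<s. \<delta> l *\<^sub>R y (l * (R + 1) + Suc (?t t l))"
      have "norm ?a \<le> 3 * real s powr (1 / p) + 1 / 4"
        by (rule le[OF block_selection[of "?t t", OF _ s(2)]]) (use t in auto)
      moreover have "norm ?b \<le> 3 * real s powr (1 / p) + 1 / 4"
        by (rule le[OF block_selection[of "\<lambda>l. Suc (?t t l)", OF _ s(2)]]) (use t in auto)
      moreover have "(\<Sum>l<s. \<delta> l *\<^sub>R ?d l (?t t l)) = ?a - ?b"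
        by (simp only: scaleR_diff_right sum_subtractf)
      then have "norm (\<Sum>l<s. \<delta> l *\<^sub>R ?d l (?t t l)) \<le> norm ?a + norm ?b"
        by (simp only: norm_triangle_ineq4)
      ultimately show ?thesis using one_le_powr[OF s(1)] by linarith
    qed
    have "(\<Sum>t<R. \<Sum>l<s. \<delta> l *\<^sub>R ?d l (?t t l))
        = (\<Sum>t<R. (\<Sum>l\<in>A. \<delta> l *\<^sub>R u l) + (\<Sum>l\<in>?B. \<delta> l *\<^sub>R ?d l t))"
      unfolding split u_def by (intro sum.cong refl arg_cong2[where f="(+)"]) auto
    also have "\<dots> = R *\<^sub>R (\<Sum>l\<in>A. \<delta> l *\<^sub>R u l) + (\<Sum>l\<in>?B. \<delta> l *\<^sub>R (\<Sum>t<R. ?d l t))"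
      by (simp add: sum.distrib sum_constant_scaleR scaleR_sum_right sum.swap[of _ ?B])
    also have "(\<lambda>l. \<Sum>t<R. ?d l t) = (\<lambda>l. y (l * (R + 1)) - y (l * (R + 1) + R))"
      using sum_lessThan_telescope'[of "\<lambda>t. y (l * (R + 1) + t)" R for l] by auto
    finally have "R *\<^sub>R (\<Sum>l\<in>A. \<delta> l *\<^sub>R u l)
        = (\<Sum>t<R. \<Sum>l<s. \<delta> l *\<^sub>R ?d l (?t t l)) - (\<Sum>l\<in>?B. \<delta> l *\<^sub>R (y (l * (R + 1)) - y (l * (R + 1) + R)))"
      by simp
    then have "norm (R *\<^sub>R (\<Sum>l\<in>A. \<delta> l *\<^sub>R u l)) \<le> norm (\<Sum>t<R. \<Sum>l<s. \<delta> l *\<^sub>R ?d l (?t t l))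
        + norm (\<Sum>l\<in>?B. \<delta> l *\<^sub>R (y (l * (R + 1)) - y (l * (R + 1) + R)))"
      by (simp only: norm_triangle_ineq4)
    moreover have "norm (\<Sum>t<R. \<Sum>l<s. \<delta> l *\<^sub>R ?d l (?t t l)) \<le> (\<Sum>t<R. 7 * real s powr (1 / p))"
      by (rule sum_norm_le) (use v in auto)
    moreover have "norm (\<Sum>l\<in>?B. \<delta> l *\<^sub>R (y (l * (R + 1)) - y (l * (R + 1) + R))) \<le> 4 * real s"
    proof -
      have "norm (\<delta> l *\<^sub>R (y (l * (R + 1)) - y (l * (R + 1) + R))) \<le> 4" if "l \<in> ?B" for l
      proof -
        have l: "l < s" "l < 2 * k" using that s by auto
        have "norm (y (l * (R + 1)) - y (l * (R + 1) + R)) \<le> norm (y (l * (R + 1))) + norm (y (l * (R + 1) + R))"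
          by (rule norm_triangle_ineq4)
        also have "\<dots> \<le> 2 + 2"
          using block_less[OF l(2), of 0] block_less[OF l(2), of R] by (intro add_mono norm_y) auto
        finally show ?thesis using \<delta>[OF l(1)] by auto
      qed
      then have "norm (\<Sum>l\<in>?B. \<delta> l *\<^sub>R (y (l * (R + 1)) - y (l * (R + 1) + R))) \<le> (\<Sum>l\<in>?B. 4)"
        by (rule sum_norm_le)
      also have "\<dots> \<le> 4 * real s"
        using card_mono[of "{..<s}" ?B] by simp
      finally show ?thesis .
    qed
    ultimately have "norm (R *\<^sub>R (\<Sum>l\<in>A. \<delta> l *\<^sub>R u l)) \<le> R * (7 * real s powr (1 / p)) + 4 * real s"
      by (simp only: sum_constant card_lessThan)
    moreover have "4 * real s \<le> real R" using R s by linarith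
    moreover have "real R \<le> R * real s powr (1 / p)"
      using mult_left_mono[OF one_le_powr[OF s(1)], of "real R"] by simp
    ultimately have "R * norm (\<Sum>l\<in>A. \<delta> l *\<^sub>R u l) \<le> R * (8 * real s powr (1 / p))"
      by simp
    then show ?thesis using R_pos by simp
  qed
  with \<delta> show thesis by (rule that)
qed

text \<open>
  A sum of differences is a combination of the \<open>y j\<close> with alternating signs, to which the spreading
  property applies.
\<close>

lemma sum_u_as_alternating:
  assumes A: "A \<subseteq> {..<2 * k}" "card A = c"
  obtains i where "strict_mono_on {..<2 * c} i" "\<And>l. l < 2 * c \<Longrightarrow> i l < L"
    "(\<Sum>l<2 * c. ((- 1) ^ l) *\<^sub>R y (i l)) = (\<Sum>l\<in>A. u l)"
proof -
  have "finite A" using A finite_subset by blast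
  then obtain a where a: "strict_mono_on {..<c} a" "a ` {..<c} = A"
    using A(2) strict_mono_enumeration by blast
  define i where "i l = a (l div 2) * (R + 1) + l mod 2" for l
  have ak: "a l < 2 * k" if "l < c" for l using a(2) A(1) that by auto
  have mod: "l mod 2 \<le> R" for l :: nat using R_pos by (metis Suc_1 mod_less_divisor less_Suc_eq_le order_trans pos2 One_nat_def)
  show thesis
  proof (rule that[of i])
    show "strict_mono_on {..<2 * c} i"
    proof (rule strict_mono_onI)
      fix l l' assume l: "l \<in> {..<2 * c}" "l' \<in> {..<2 * c}" "l < l'"
      show "i l < i l'"
      proof (cases "l div 2 = l' div 2")
        case True
        have "l div 2 * 2 + l mod 2 < l' div 2 * 2 + l' mod 2" using l(3) by (simp only: div_mult_mod_eq)
        then have "l mod 2 < l' mod 2" using True by (simp only: nat_add_left_cancel_less)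
        then show ?thesis using True by (simp add: i_def)
      next
        case False
        then have "l div 2 < l' div 2" using l(3) by (meson div_le_mono le_neq_implies_less less_imp_le)
        moreover have "l div 2 < c" "l' div 2 < c" using l by auto
        ultimately have "a (l div 2) < a (l' div 2)" using a(1) by (simp add: strict_mono_on_def)
        then show ?thesis unfolding i_def by (rule block_mono[OF _ mod])
      qed
    qed
    show "i l < L" if "l < 2 * c" for l
      unfolding i_def using that by (intro block_less mod ak) auto
    have "(\<Sum>l<2 * c. ((- 1) ^ l) *\<^sub>R y (i l)) = (\<Sum>l<c. u (a l))"
      unfolding sum_pairs by (simp add: i_def u_def)
    also have "\<dots> = (\<Sum>l\<in>A. u l)"
      using a sum.reindex[of a "{..<c}" u] strict_mono_on_imp_inj_on[OF a(1)] by simp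
    finally show "(\<Sum>l<2 * c. ((- 1) ^ l) *\<^sub>R y (i l)) = (\<Sum>l\<in>A. u l)" .
  qed
qed

text \<open>
  Among \<open>2 c\<close> good signs, \<open>c\<close> agree.  Suppression of the other indices gives the estimate for one index
  set of size \<open>c\<close>, and the spreading property carries it over to all of them.
\<close>

lemma norm_sum_u_le:
  assumes S: "S \<subseteq> {..<k}"
  shows "norm (\<Sum>l\<in>S. u l) \<le> 17 * real (card S) powr (1 / p)"
proof (cases "S = {}")
  case False
  define c where "c = card S"
  have Sfin: "finite S" using S finite_subset by blast
  have c: "1 \<le> c" "c \<le> k"
    using False Sfin card_mono[of "{..<k}" S] S by (auto simp: c_def Suc_le_eq card_gt_0_iff)
  obtain \<delta> :: "nat \<Rightarrow> real" where \<delta>: "\<And>l. l < 2 * c \<Longrightarrow> \<delta> l \<in> {- 1, 1}"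
    and le: "\<And>A. A \<subseteq> {..<2 * c} \<Longrightarrow> norm (\<Sum>l\<in>A. \<delta> l *\<^sub>R u l) \<le> 8 * real (2 * c) powr (1 / p)"
    by (rule good_signs_suppression[of "2 * c"]) (use c in auto)
  define P where "P a = {l. l < 2 * c \<and> \<delta> l = a}" for a
  have "card (P 1 \<union> P (- 1)) = 2 * c"
  proof -
    have "P 1 \<union> P (- 1) = {..<2 * c}" using \<delta> by (auto simp: P_def)
    then show ?thesis by simp
  qed
  then have "2 * c \<le> card (P 1) + card (P (- 1))" by (metis card_Un_le)
  then obtain a where a: "a \<in> {- 1, 1}" "c \<le> card (P a)"
    by (metis add_le_mono insertCI mult_2 nat_le_linear not_less_eq_eq order_trans add_less_mono not_le)
  then obtain A where A: "A \<subseteq> P a" "card A = c" by (meson obtain_subset_with_card_n)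
  have "norm (\<Sum>l\<in>A. u l) = norm (\<Sum>l\<in>A. \<delta> l *\<^sub>R u l)"
  proof -
    have "(\<Sum>l\<in>A. \<delta> l *\<^sub>R u l) = a *\<^sub>R (\<Sum>l\<in>A. u l)"
      unfolding scaleR_sum_right using A(1) by (intro sum.cong) (auto simp: P_def)
    then show ?thesis using a by auto
  qed
  also have "\<dots> \<le> 8 * real (2 * c) powr (1 / p)" by (rule le) (use A in \<open>auto simp: P_def\<close>)
  also have "\<dots> = 8 * (2 powr (1 / p) * real c powr (1 / p))" by (simp add: powr_mult)
  also have "\<dots> \<le> 8 * (2 powr 1 * real c powr (1 / p))"
    using p by (intro mult_left_mono mult_right_mono powr_mono) auto
  finally have A16: "norm (\<Sum>l\<in>A. u l) \<le> 16 * real c powr (1 / p)" by simp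
  have "A \<subseteq> {..<2 * k}" using A c by (auto simp: P_def)
  from this A(2) obtain i where i: "strict_mono_on {..<2 * c} i" "\<And>l. l < 2 * c \<Longrightarrow> i l < L"
    "(\<Sum>l<2 * c. ((- 1) ^ l) *\<^sub>R y (i l)) = (\<Sum>l\<in>A. u l)" by (rule sum_u_as_alternating) blast
  have "S \<subseteq> {..<2 * k}" using S by auto
  from this c_def[symmetric] obtain i' where i': "strict_mono_on {..<2 * c} i'" "\<And>l. l < 2 * c \<Longrightarrow> i' l < L"
    "(\<Sum>l<2 * c. ((- 1) ^ l) *\<^sub>R y (i' l)) = (\<Sum>l\<in>S. u l)" by (rule sum_u_as_alternating) blast
  have "norm (\<Sum>l<2 * c. ((- 1) ^ l) *\<^sub>R y (i' l)) \<le> norm (\<Sum>l<2 * c. ((- 1) ^ l) *\<^sub>R y (i l)) + 1 / 4"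
  proof (rule spreading_initial[OF spread])
    show "(- 1) ^ l \<in> {- 1, 1::real}" for l :: nat by (cases "even l") auto
  qed (use c i i' in auto)
  then show ?thesis using A16 one_le_powr[OF c(1)] unfolding i i' c_def[symmetric] by linarith
qed simp

lemma norm_signed_sum_u_le:
  assumes S: "S \<subseteq> {..<k}" and \<epsilon>: "\<And>l. l \<in> S \<Longrightarrow> \<epsilon> l \<in> {- 1, 1}"
  shows "norm (\<Sum>l\<in>S. \<epsilon> l *\<^sub>R u l) \<le> 34 * real (card S) powr (1 / p)"
proof -
  have Sfin: "finite S" using S finite_subset by blast
  let ?P = "{l\<in>S. \<epsilon> l = 1}"
  have le: "norm (\<Sum>l\<in>T. u l) \<le> 17 * real (card S) powr (1 / p)" if "T \<subseteq> S" for T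
  proof -
    have "norm (\<Sum>l\<in>T. u l) \<le> 17 * real (card T) powr (1 / p)"
      by (rule norm_sum_u_le) (use that S in auto)
    also have "\<dots> \<le> 17 * real (card S) powr (1 / p)"
      using card_mono[OF Sfin that] p by (intro mult_left_mono powr_mono2) auto
    finally show ?thesis .
  qed
  have "(\<Sum>l\<in>S. \<epsilon> l *\<^sub>R u l) = (\<Sum>l\<in>S - ?P. \<epsilon> l *\<^sub>R u l) + (\<Sum>l\<in>?P. \<epsilon> l *\<^sub>R u l)"
    by (rule sum.subset_diff) (use Sfin in auto)
  also have "(\<Sum>l\<in>?P. \<epsilon> l *\<^sub>R u l) = (\<Sum>l\<in>?P. u l)" by (intro sum.cong) auto
  also have "(\<Sum>l\<in>S - ?P. \<epsilon> l *\<^sub>R u l) = - (\<Sum>l\<in>S - ?P. u l)"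
    unfolding sum_negf[symmetric]
  proof (rule sum.cong[OF refl])
    fix l assume "l \<in> S - ?P"
    then have "\<epsilon> l = - 1" using \<epsilon>[of l] by auto
    then show "\<epsilon> l *\<^sub>R u l = - u l" by simp
  qed
  finally have "norm (\<Sum>l\<in>S. \<epsilon> l *\<^sub>R u l) \<le> norm (\<Sum>l\<in>S - ?P. u l) + norm (\<Sum>l\<in>?P. u l)"
    using norm_triangle_ineq[of "- (\<Sum>l\<in>S - ?P. u l)" "\<Sum>l\<in>?P. u l"] by (simp only: norm_minus_cancel)
  then show ?thesis using le[of ?P] le[of "S - ?P"] by auto
qed

text \<open>
  Otherwise all \<open>y j\<close> would be close to \<open>y 0\<close>, and a functional norming \<open>y 0\<close> would be at least \<open>1/2\<close> at
  each of them, which makes the Rademacher average of all \<open>L\<close> vectors at least of order \<open>sqrt L\<close>.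
\<close>

lemma norm_u_ge:
  assumes l: "l < k" shows "1 / 4 \<le> norm (u l)"
proof (rule ccontr)
  assume small: "\<not> ?thesis"
  have L0: "0 < L" using block_less[of 0 0] k by auto
  have diff: "norm (y 0 - y j) \<le> 1 / 2" if j: "j < L" for j
  proof (cases "j = 0")
    case False
    let ?b = "\<lambda>l::nat. if l = 0 then 1 else - 1 :: real"
    have "norm (\<Sum>t<2. ?b t *\<^sub>R y (if t = 0 then 0 else j))
        \<le> norm (\<Sum>t<2. ?b t *\<^sub>R y (l * (R + 1) + t)) + 1 / 4"
    proof (rule spreading_initial[OF spread])
      show "l * (R + 1) + t < L" if "t < 2" for t using that R_pos l by (intro block_less) auto
    qed (use k L0 j False in \<open>auto simp: strict_mono_on_def\<close>)
    then have "norm (y 0 - y j) \<le> norm (u l) + 1 / 4"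
      by (simp add: numeral_2_eq_2 u_def)
    then show ?thesis using small by linarith
  qed simp
  obtain f :: "'x \<Rightarrow> real" where f: "linear f" "\<And>x. f x \<le> norm x" "f (y 0) = norm (y 0)"
    by (rule real_norming_functional[of "y 0"]) blast
  have "\<bar>f x\<bar> \<le> norm x" for x
    using f(2)[of x] f(2)[of "- x"] by (simp add: linear_neg[OF f(1)] abs_le_iff)
  then have "(\<Sum>j<L. (f (y j))\<^sup>2) \<le> rad_sq {..<L} y"
    by (intro rad_sq_functional_le[OF f(1)]) auto
  also have "\<dots> \<le> 8 * real L powr (2 / p)" using rad_y[of "{..<L}"] by simp
  finally have "(\<Sum>j<L. (f (y j))\<^sup>2) \<le> 8 * real L powr (2 / p)" .
  moreover have "(\<Sum>j<L. (1 / 2)\<^sup>2) \<le> (\<Sum>j<L. (f (y j))\<^sup>2)"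
  proof (intro sum_mono power_mono)
    fix j assume "j \<in> {..<L}"
    then have "f (y 0 - y j) \<le> 1 / 2" using diff[of j] f(2)[of "y 0 - y j"] by simp
    then show "1 / 2 \<le> f (y j)" using norm_y(1)[OF L0] f(3) by (simp add: linear_diff[OF f(1)])
  qed simp
  ultimately have "real L \<le> 32 * real L powr (2 / p)" by (simp add: power2_eq_square)
  moreover have "real L = real L powr (1 - 2 / p) * real L powr (2 / p)"
    using L0 by (simp add: powr_add[symmetric])
  moreover have "32 * real L powr (2 / p) < real L powr (1 - 2 / p) * real L powr (2 / p)"
    using L0 by (intro mult_strict_right_mono L(2)) simp
  ultimately show False by linarith
qed

end

lemma unconditional_upper_estimate_if_not_cotype:
  assumes p: "2 < p" and nc: "\<not> has_cotype TYPE('x::real_normed_vector) (ereal p)"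
  shows "\<exists>u :: nat \<Rightarrow> 'x. (\<forall>j<k. 1 \<le> norm (u j)) \<and>
     (\<forall>S \<epsilon>. S \<subseteq> {..<k} \<longrightarrow> (\<forall>j\<in>S. \<epsilon> j \<in> {- 1, 1}) \<longrightarrow>
        norm (\<Sum>j\<in>S. \<epsilon> j *\<^sub>R u j) \<le> 136 * real (card S) powr (1 / p))"
proof (cases "k = 0")
  case False
  define R where "R = 8 * k"
  obtain n where n: "(33 :: real) powr (1 / (1 - 2 / p)) \<le> real n" using real_arch_simple by blast
  define L where "L = max n (2 * k * (R + 1))"
  have "32 < (33 powr (1 / (1 - 2 / p))) powr (1 - 2 / p)" using p by (simp add: powr_powr)
  also have "\<dots> \<le> real L powr (1 - 2 / p)" using n p by (intro powr_mono2) (auto simp: L_def)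
  finally have L: "32 < real L powr (1 - 2 / p)" .
  obtain N where N: "\<And>z :: nat \<Rightarrow> 'x. (\<And>j. j < N \<Longrightarrow> norm (z j) \<le> 2) \<Longrightarrow>
    \<exists>h. strict_mono_on {..<L + 2 * k} h \<and> h ` {..<L + 2 * k} \<subseteq> {..<N} \<and> spreading (2 * k) (L + 2 * k) (z \<circ> h)"
    by (rule spreading_subsequence[where L="L + 2 * k" and m="2 * k"]) blast
  obtain z :: "nat \<Rightarrow> 'x" where z: "\<And>j. j < N \<Longrightarrow> 1 \<le> norm (z j)" "\<And>j. j < N \<Longrightarrow> norm (z j) \<le> 2"
    and rad: "\<And>S. S \<subseteq> {..<N} \<Longrightarrow> rad_sq S z \<le> 8 * real (card S) powr (2 / p)"
    using upper_estimate_if_not_cotype[OF _ nc, of N] p by (meson less_imp_le)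
  obtain h where h: "strict_mono_on {..<L + 2 * k} h" "h ` {..<L + 2 * k} \<subseteq> {..<N}"
    "spreading (2 * k) (L + 2 * k) (z \<circ> h)" using N[of z, OF z(2)] by blast
  have hN: "h j < N" if "j < L" for j using h(2) that by (simp add: image_subset_iff)
  interpret spreading_sequence "z \<circ> h" p k R L
  proof
    fix S assume S: "S \<subseteq> {..<L}"
    have "inj_on h {..<L + 2 * k}" by (rule strict_mono_on_imp_inj_on[OF h(1)])
    then have inj: "inj_on h S" by (rule inj_on_subset) (use S in auto)
    have "finite S" using S finite_subset by blast
    then have "rad_sq S (z \<circ> h) = rad_sq (h ` S) z" using inj by (simp add: rad_sq_reindex)
    also have "\<dots> \<le> 8 * real (card (h ` S)) powr (2 / p)" by (rule rad) (use S hN in auto)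
    finally show "rad_sq S (z \<circ> h) \<le> 8 * real (card S) powr (2 / p)" using inj by (simp add: card_image)
  qed (use p False L h z hN in \<open>auto simp: R_def L_def\<close>)
  show ?thesis
  proof (intro exI[of _ "\<lambda>l. 4 *\<^sub>R u l"] conjI allI impI)
    fix j assume "j < k" then show "1 \<le> norm (4 *\<^sub>R u j)" using norm_u_ge[of j] by simp
  next
    fix S and \<epsilon> :: "nat \<Rightarrow> real" assume S: "S \<subseteq> {..<k}" "\<forall>j\<in>S. \<epsilon> j \<in> {- 1, 1}"
    have "(\<Sum>j\<in>S. \<epsilon> j *\<^sub>R 4 *\<^sub>R u j) = 4 *\<^sub>R (\<Sum>j\<in>S. \<epsilon> j *\<^sub>R u j)"
      by (simp add: scaleR_sum_right mult.commute)
    then show "norm (\<Sum>j\<in>S. \<epsilon> j *\<^sub>R 4 *\<^sub>R u j) \<le> 136 * real (card S) powr (1 / p)"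
      using norm_signed_sum_u_le[OF S(1), of \<epsilon>] S(2) by simp
  qed
qed simp

section \<open>Uniform boundedness for exponents at most one\<close>

lemma powr_add_le:
  fixes a b s :: real
  assumes "0 \<le> a" "0 \<le> b" "0 < s" "s \<le> 1"
  shows "(a + b) powr s \<le> a powr s + b powr s"
proof (cases "a + b = 0")
  case False
  then have ab: "0 < a + b" using assms by linarith
  have "1 = a / (a + b) + b / (a + b)" using False by (simp add: add_divide_distrib[symmetric])
  also have "\<dots> \<le> (a / (a + b)) powr s + (b / (a + b)) powr s"
    using assms ab powr_mono'[of s 1 "a / (a + b)"] powr_mono'[of s 1 "b / (a + b)"]
    by (intro add_mono) auto
  also have "\<dots> = (a powr s + b powr s) / (a + b) powr s"
    by (simp add: powr_divide add_divide_distrib)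
  finally show ?thesis using ab by (simp add: pos_le_divide_eq)
qed (use assms in auto)

text \<open>
  The functional \<open>z \<mapsto> \<Sum>\<^sub>i |z\<^sub>i|\<^sup>s\<close> is subadditive for \<open>s \<le> 1\<close>, so the proof of the Banach-Steinhaus theorem by
  Baire's category theorem applies although it is not a power of a norm.
\<close>

lemma uniform_boundedness_powr:
  fixes T :: "nat \<Rightarrow> 'b::{real_normed_vector, complete_space} \<Rightarrow> 'c::real_normed_vector"
  assumes T: "\<And>i. bounded_linear (T i)" and s: "0 < s" "s \<le> 1"
    and summ: "\<And>b. summable (\<lambda>i. norm (T i b) powr s)"
  obtains M where "\<And>b n. norm b \<le> 1 \<Longrightarrow> (\<Sum>i<n. norm (T i b) powr s) \<le> M"
proof -
  define F where "F m = {b. \<forall>n. (\<Sum>i<n. norm (T i b) powr s) \<le> real m}" for m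
  have closed: "closed (F m)" for m
    unfolding F_def
  proof (intro closed_Collect_all closed_Collect_le continuous_on_const)
    fix n
    have "continuous_on UNIV (\<lambda>b. norm (T i b) powr s)" for i
      using s by (intro continuous_on_powr' continuous_on_norm bounded_linear.continuous_on[OF T] continuous_intros) auto
    then show "continuous_on UNIV (\<lambda>b. \<Sum>i<n. norm (T i b) powr s)" by (intro continuous_on_sum)
  qed
  have "b \<in> (\<Union>m. F m)" for b
  proof -
    obtain m where m: "(\<Sum>i. norm (T i b) powr s) \<le> real m" using real_arch_simple by blast
    have "(\<Sum>i<n. norm (T i b) powr s) \<le> real m" for n
      using sum_le_suminf[OF summ, of "{..<n}" b] m by fastforce
    then show ?thesis by (auto simp: F_def)
  qed
  then have UN: "\<Union>(range F) = UNIV" by blast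
  obtain m where m: "interior (F m) \<noteq> {}"
  proof (rule ccontr)
    assume "\<not> thesis"
    then have *: "\<And>m. interior (F m) = {}" using that by blast
    have "euclidean interior_of \<Union>(range F) = {}"
    proof (rule Baire_category_alt)
      show "completely_metrizable_space (euclidean :: 'b topology) \<or>
          locally_compact_space (euclidean :: 'b topology) \<and> regular_space (euclidean :: 'b topology)"
        by (simp add: completely_metrizable_space_euclidean)
    qed (use closed * in auto)
    then show False unfolding UN by simp
  qed
  then obtain b0 e where e: "0 < e" "ball b0 e \<subseteq> F m" by (meson ex_in_conv mem_interior)
  show thesis
  proof (rule that)
    fix b :: 'b and n assume b: "norm b \<le> 1"
    let ?h = "e / 2"
    have sub: "norm (?h *\<^sub>R b) < e" using b e(1) mult_left_le[of "norm b" ?h] by simp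
    have mem: "b0 \<in> F m" "b0 + ?h *\<^sub>R b \<in> F m" using e sub by (auto simp: subset_iff dist_norm)
    have "?h powr s * (\<Sum>i<n. norm (T i b) powr s)
        \<le> (\<Sum>i<n. norm (T i (b0 + ?h *\<^sub>R b)) powr s + norm (T i b0) powr s)"
      unfolding sum_distrib_left
    proof (rule sum_mono)
      fix i
      have "T i (?h *\<^sub>R b) = T i (b0 + ?h *\<^sub>R b) - T i b0"
        using bounded_linear.linear[OF T[of i]] by (simp add: linear_add)
      then have "norm (T i (?h *\<^sub>R b)) \<le> norm (T i (b0 + ?h *\<^sub>R b)) + norm (T i b0)"
        by (simp only: norm_triangle_ineq4)
      then have "norm (T i (?h *\<^sub>R b)) powr s \<le> (norm (T i (b0 + ?h *\<^sub>R b)) + norm (T i b0)) powr s"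
        using s by (intro powr_mono2) auto
      also have "\<dots> \<le> norm (T i (b0 + ?h *\<^sub>R b)) powr s + norm (T i b0) powr s"
        using s by (intro powr_add_le) auto
      also have "norm (T i (?h *\<^sub>R b)) powr s = ?h powr s * norm (T i b) powr s"
        unfolding linear_cmul[OF bounded_linear.linear[OF T]] powr_mult[symmetric] using e(1) by simp
      finally show "?h powr s * norm (T i b) powr s \<le> norm (T i (b0 + ?h *\<^sub>R b)) powr s + norm (T i b0) powr s" .
    qed
    also have "\<dots> \<le> real m + real m"
      using mem unfolding sum.distrib F_def by (intro add_mono) auto
    finally show "(\<Sum>i<n. norm (T i b) powr s) \<le> 2 * real m / ?h powr s"
      using e(1) by (simp add: pos_le_divide_eq mult.commute)
  qed
qed

text \<open>
  Flipping the sign of the \<open>i\<close>-th term changes the sum by \<open>2 a\<^sub>i\<close>, so one of the two sums has norm at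
  least that of \<open>a\<^sub>i\<close>.
\<close>

lemma sign_avg_powr_ge:
  fixes a :: "nat \<Rightarrow> 'c::real_normed_vector"
  assumes s: "0 < s" "s \<le> 1" and i: "i < n"
  shows "norm (a i) powr s / 2 \<le> sign_avg {..<n} (\<lambda>\<eta>. norm (\<Sum>l<n. \<eta> l *\<^sub>R a l) powr s)"
proof -
  let ?F = "\<lambda>\<eta>. norm (\<Sum>l<n. \<eta> l *\<^sub>R a l) powr s"
  let ?\<sigma> = "\<lambda>l. if l = i then - 1 else 1 :: real"
  have flip: "sign_avg {..<n} (\<lambda>\<eta>. ?F (\<lambda>l. ?\<sigma> l * \<eta> l)) = sign_avg {..<n} ?F"
  proof (rule sign_avg_flip[where F="?F"])
    fix \<epsilon> \<epsilon>' :: "nat \<Rightarrow> real" assume "\<And>j. j \<in> {..<n} \<Longrightarrow> \<epsilon> j = \<epsilon>' j"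
    then have "(\<Sum>l<n. \<epsilon> l *\<^sub>R a l) = (\<Sum>l<n. \<epsilon>' l *\<^sub>R a l)" by (intro sum.cong) auto
    then show "?F \<epsilon> = ?F \<epsilon>'" by simp
  qed auto
  have "norm (a i) powr s / 2 = sign_avg {..<n} (\<lambda>\<eta>. norm (a i) powr s / 2)"
    by (simp add: sign_avg_const)
  also have "\<dots> \<le> sign_avg {..<n} (\<lambda>\<eta>. 1 / 2 * (?F \<eta> + ?F (\<lambda>l. ?\<sigma> l * \<eta> l)))"
  proof (rule sign_avg_mono)
    fix \<eta> assume \<eta>: "\<eta> \<in> {..<n} \<rightarrow>\<^sub>E {- 1, 1::real}"
    let ?x = "\<Sum>l<n. \<eta> l *\<^sub>R a l" and ?y = "\<Sum>l<n. (?\<sigma> l * \<eta> l) *\<^sub>R a l"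
    have "?x - ?y = (\<Sum>l<n. if l = i then (2 * \<eta> i) *\<^sub>R a i else 0)"
      unfolding sum_subtractf[symmetric] scaleR_diff_left[symmetric] by (intro sum.cong) simp_all
    also have "\<dots> = (2 * \<eta> i) *\<^sub>R a i" using i by simp
    finally have "norm (?x - ?y) = 2 * norm (a i)"
      using PiE_mem[OF \<eta>, of i] i by auto
    then have "norm (a i) \<le> norm ?x + norm ?y"
      using norm_triangle_ineq4[of ?x ?y] by (smt (verit) norm_ge_zero)
    then have "norm (a i) powr s \<le> (norm ?x + norm ?y) powr s" using s by (intro powr_mono2) auto
    also have "\<dots> \<le> ?F \<eta> + ?F (\<lambda>l. ?\<sigma> l * \<eta> l)" using s by (intro powr_add_le) auto
    finally show "norm (a i) powr s / 2 \<le> 1 / 2 * (?F \<eta> + ?F (\<lambda>l. ?\<sigma> l * \<eta> l))" by simp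
  qed
  also have "\<dots> = sign_avg {..<n} ?F" unfolding sign_avg_cmult sign_avg_add flip by simp
  finally show ?thesis .
qed

text \<open>
  If all bounded combinations were \<open>s\<close>-summable, uniform boundedness would bound the partial sums for
  all choices of signs at once; on average over the signs, the \<open>i\<close>-th row contributes at least half of
  \<open>norm (a i i) powr s\<close>.
\<close>

lemma not_summable_combination:
  fixes a :: "nat \<Rightarrow> nat \<Rightarrow> 'c::banach"
  assumes s: "0 < s" "s \<le> 1" and rows: "\<And>i. summable (\<lambda>l. norm (a i l))"
    and diag: "\<not> summable (\<lambda>i. norm (a i i) powr s)"
  obtains b :: "nat \<Rightarrow> real" where "\<And>l. \<bar>b l\<bar> \<le> 1"
    "\<not> summable (\<lambda>i. norm (\<Sum>l. b l *\<^sub>R a i l) powr s)"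
proof (rule ccontr)
  assume "\<not> thesis"
  then have summ: "summable (\<lambda>i. norm (\<Sum>l. b l *\<^sub>R a i l) powr s)" if "\<And>l. \<bar>b l\<bar> \<le> 1" for b
    using that \<open>\<And>b. (\<And>l. \<bar>b l\<bar> \<le> 1) \<Longrightarrow> \<not> summable (\<lambda>i. norm (\<Sum>l. b l *\<^sub>R a i l) powr s) \<Longrightarrow> thesis\<close> by blast
  \<comment> \<open>The bounded sequences are taken as the values at the natural numbers of bounded continuous
    functions on the real line, which form a complete space.\<close>
  define T where "T i b = (\<Sum>l. apply_bcontfun b (real l) *\<^sub>R a i l)" for i and b :: "real \<Rightarrow>\<^sub>C real"
  have row: "summable (\<lambda>l. norm (apply_bcontfun b (real l) *\<^sub>R a i l))" for b :: "real \<Rightarrow>\<^sub>C real" and i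
  proof (rule summable_comparison_test')
    show "summable (\<lambda>l. norm b * norm (a i l))" using rows by (rule summable_mult)
    show "norm (norm (apply_bcontfun b (real l) *\<^sub>R a i l)) \<le> norm b * norm (a i l)" for l
      using norm_bounded[of b "real l"] by (simp add: mult_right_mono)
  qed
  have lin: "bounded_linear (T i)" for i
  proof (rule bounded_linear_intro)
    show "T i (b + b') = T i b + T i b'" for b b'
      unfolding T_def using suminf_add[OF summable_norm_cancel[OF row] summable_norm_cancel[OF row]]
      by (simp add: scaleR_left_distrib)
    show "T i (c *\<^sub>R b) = c *\<^sub>R T i b" for c b
      unfolding T_def using suminf_scaleR_right[OF summable_norm_cancel[OF row[of b i]], of c] by simp
    show "norm (T i b) \<le> norm b * (\<Sum>l. norm (a i l))" for b
    proof -
      have "norm (T i b) \<le> (\<Sum>l. norm (apply_bcontfun b (real l) *\<^sub>R a i l))"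
        unfolding T_def by (rule summable_norm[OF row])
      also have "\<dots> \<le> (\<Sum>l. norm b * norm (a i l))"
        using norm_bounded[of b] by (intro suminf_le row summable_mult rows) (simp add: mult_right_mono)
      also have "\<dots> = norm b * (\<Sum>l. norm (a i l))" by (rule suminf_mult[OF rows])
      finally show ?thesis .
    qed
  qed
  have summT: "summable (\<lambda>i. norm (T i b) powr s)" for b
  proof -
    define c where "c = norm b + 1"
    have c: "0 < c" by (simp add: c_def add_nonneg_pos)
    have "\<bar>apply_bcontfun ((1 / c) *\<^sub>R b) (real l)\<bar> \<le> 1" for l
      using norm_bounded[of b "real l"] c by (simp add: c_def)
    then have "summable (\<lambda>i. norm (T i ((1 / c) *\<^sub>R b)) powr s)" unfolding T_def by (rule summ)
    then have "summable (\<lambda>i. c powr s * norm (T i ((1 / c) *\<^sub>R b)) powr s)" by (rule summable_mult)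
    moreover have "c powr s * norm (T i ((1 / c) *\<^sub>R b)) powr s = norm (T i b) powr s" for i
      using c by (simp add: linear_cmul[OF bounded_linear.linear[OF lin]] powr_mult[symmetric])
    ultimately show ?thesis by simp
  qed
  obtain M where M: "\<And>b n. norm b \<le> 1 \<Longrightarrow> (\<Sum>i<n. norm (T i b) powr s) \<le> M"
    by (rule uniform_boundedness_powr[OF lin s summT]) blast
  have "(\<Sum>i<n. norm (a i i) powr s) \<le> 2 * M" for n
  proof -
    have "(\<Sum>i<n. norm (a i i) powr s / 2)
        \<le> (\<Sum>i<n. sign_avg {..<n} (\<lambda>\<eta>. norm (\<Sum>l<n. \<eta> l *\<^sub>R a i l) powr s))"
      using s by (intro sum_mono sign_avg_powr_ge) auto
    also have "\<dots> = sign_avg {..<n} (\<lambda>\<eta>. \<Sum>i<n. norm (\<Sum>l<n. \<eta> l *\<^sub>R a i l) powr s)"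
      by (simp only: sign_avg_sum)
    also have "\<dots> \<le> sign_avg {..<n} (\<lambda>_. M)"
    proof (rule sign_avg_mono)
      fix \<eta> assume \<eta>: "\<eta> \<in> {..<n} \<rightarrow>\<^sub>E {- 1, 1::real}"
      \<comment> \<open>A clamped sum of hat functions interpolates the signs without increasing the supremum norm.\<close>
      define g where "g x = max (- 1) (min 1 (\<Sum>l<n. \<eta> l * max 0 (1 - \<bar>x - real l\<bar>)))" for x
      have "continuous_on UNIV g" unfolding g_def by (intro continuous_intros)
      moreover have g1: "norm (g x) \<le> 1" for x by (simp add: g_def)
      ultimately have "g \<in> bcontfun" by (rule bcontfun_normI)
      then have g: "apply_bcontfun (Bcontfun g) = g" by (rule Bcontfun_inverse)
      have g_nat: "g (real j) = (if j < n then \<eta> j else 0)" for j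
      proof -
        have "(\<Sum>l<n. \<eta> l * max 0 (1 - \<bar>real j - real l\<bar>)) = (\<Sum>l<n. if l = j then \<eta> l else 0)"
          by (intro sum.cong) auto
        then show ?thesis using PiE_mem[OF \<eta>, of j] by (auto simp: g_def)
      qed
      have Tg: "T i (Bcontfun g) = (\<Sum>l<n. \<eta> l *\<^sub>R a i l)" for i
      proof -
        have "T i (Bcontfun g) = (\<Sum>l\<in>{..<n}. g (real l) *\<^sub>R a i l)"
          unfolding T_def g by (rule suminf_finite) (auto simp: g_nat)
        then show ?thesis by (simp add: g_nat)
      qed
      have "norm (Bcontfun g) \<le> 1" using g1 by (intro norm_bound) (simp add: g)
      from M[OF this, of n] show "(\<Sum>i<n. norm (\<Sum>l<n. \<eta> l *\<^sub>R a i l) powr s) \<le> M"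
        by (simp only: Tg)
    qed
    finally show ?thesis by (simp add: sign_avg_const sum_divide_distrib[symmetric])
  qed
  then have "summable (\<lambda>i. norm (a i i) powr s)" by (intro summableI_nonneg_bounded) auto
  with diag show False ..
qed

section \<open>Weak summability and the polynomial\<close>

lemma powr_increment_ge:
  fixes s :: real
  assumes s: "0 < s" "s \<le> 1" and k: "1 \<le> k"
  shows "s * real k powr (s - 1) + real (k - 1) powr s \<le> real k powr s"
proof (cases "k = 1")
  case False
  let ?x = "1 - 1 / real k"
  have x: "0 < ?x" using k False by simp
  have "?x powr s * 1 powr (1 - s) \<le> s * ?x + (1 - s) * 1"
    using x s by (intro Youngs_inequality_0) auto
  then have "real k powr s * ?x powr s \<le> real k powr s * (1 - s / real k)"
    by (intro mult_left_mono) (auto simp: algebra_simps)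
  moreover have "real k powr s * ?x powr s = real (k - 1) powr s"
    using k by (simp add: powr_mult[symmetric] algebra_simps of_nat_diff)
  moreover have "real k powr s * (1 - s / real k) = real k powr s - s * real k powr (s - 1)"
    using k by (simp add: powr_diff algebra_simps)
  ultimately show ?thesis by linarith
qed (use s in simp)

text \<open>
  The smallest of the numbers is at most their mean, hence at most \<open>K |S|\<^bsup>1/p - 1\<^esup>\<close>; removing it and
  repeating this leads to the sum of the numbers \<open>j\<^bsup>r(1/p - 1)\<^esup>\<close>.
\<close>

lemma sum_powr_le_if_weak_estimate:
  fixes a :: "'a \<Rightarrow> real"
  assumes "finite S" and a: "\<And>j. j \<in> S \<Longrightarrow> 0 \<le> a j" and r: "0 < r" and p: "1 \<le> p"
    and r\<rho>: "r * (1 - 1 / p) < 1"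
    and le: "\<And>T. T \<subseteq> S \<Longrightarrow> (\<Sum>j\<in>T. a j) \<le> K * real (card T) powr (1 / p)"
  shows "(\<Sum>j\<in>S. a j powr r) \<le> K powr r / (1 - r * (1 - 1 / p)) * real (card S) powr (1 - r * (1 - 1 / p))"
  using assms(1,2,6)
proof (induction "card S" arbitrary: S)
  case (Suc n)
  let ?s = "1 - r * (1 - 1 / p)"
  have s: "0 < ?s" "?s \<le> 1" using r\<rho> r p by auto
  have factor: "x * A + x / c * B = x / c * (c * A + B)" if "c \<noteq> 0" for x A B c :: real
    using that by (simp add: field_simps)
  have ne: "S \<noteq> {}" and fin: "finite S" using Suc by auto
  have "Min (a ` S) \<in> a ` S" using fin ne by (intro Min_in) auto
  then obtain i where i: "i \<in> S" and "Min (a ` S) = a i" by auto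
  then have min: "a i \<le> a j" if "j \<in> S" for j
    using Min_le[of "a ` S" "a j"] fin that by simp
  define k where "k = card S"
  have k: "1 \<le> k" "n = k - 1" using Suc.hyps(2) by (auto simp: k_def)
  have "k * a i = (\<Sum>j\<in>S. a i)" by (simp add: k_def)
  also have "\<dots> \<le> (\<Sum>j\<in>S. a j)" by (rule sum_mono) (rule min)
  also have "\<dots> \<le> K * real k powr (1 / p)" using Suc.prems(3)[of S] by (simp add: k_def)
  finally have "a i \<le> K * real k powr (1 / p - 1)"
    using k by (simp add: powr_diff field_simps)
  then have "a i powr r \<le> (K * real k powr (1 / p - 1)) powr r"
    using Suc.prems(2)[OF i] r by (intro powr_mono2) auto
  also have "\<dots> = K powr r * real k powr (?s - 1)"
    by (simp add: powr_mult powr_powr algebra_simps)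
  finally have ai: "a i powr r \<le> K powr r * real k powr (?s - 1)" .
  have "(\<Sum>j\<in>S - {i}. a j powr r) \<le> K powr r / ?s * real (card (S - {i})) powr ?s"
    using Suc i by (intro Suc.hyps(1)) auto
  also have "card (S - {i}) = k - 1" using i by (simp add: k_def)
  finally have rest: "(\<Sum>j\<in>S - {i}. a j powr r) \<le> K powr r / ?s * real (k - 1) powr ?s" .
  have "(\<Sum>j\<in>S. a j powr r) = a i powr r + (\<Sum>j\<in>S - {i}. a j powr r)"
    using fin i by (rule sum.remove)
  also have "\<dots> \<le> K powr r * real k powr (?s - 1) + K powr r / ?s * real (k - 1) powr ?s"
    using ai rest by (rule add_mono)
  also have "\<dots> = K powr r / ?s * (?s * real k powr (?s - 1) + real (k - 1) powr ?s)"
    by (rule factor) (use s(1) in simp)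
  also have "\<dots> \<le> K powr r / ?s * real k powr ?s"
    using s k powr_increment_ge[OF s k(1)] by (intro mult_left_mono) auto
  finally show ?case by (simp add: k_def)
qed auto

text \<open>
  Families indexed by a block \<open>m\<close> and a position \<open>j < k m\<close> become sequences along the pairing function,
  with zeros at the pairs outside the blocks.
\<close>

lemma sum_over_prod_decode_le:
  fixes f :: "nat \<times> nat \<Rightarrow> real" and k :: "nat \<Rightarrow> nat"
  assumes nonneg: "\<And>z. 0 \<le> f z" and zero: "\<And>m j. k m \<le> j \<Longrightarrow> f (m, j) = 0"
    and le: "\<And>m. (\<Sum>j<k m. f (m, j)) \<le> g m" and g: "summable g"
  shows "summable (\<lambda>n. f (prod_decode n))" "(\<Sum>n. f (prod_decode n)) \<le> (\<Sum>m. g m)"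
proof -
  have g0: "0 \<le> g m" for m using le[of m] nonneg by (meson order_trans sum_nonneg)
  have part: "(\<Sum>n<N. f (prod_decode n)) \<le> (\<Sum>m. g m)" for N
  proof -
    let ?A = "prod_decode ` {..<N}"
    define M where "M = Suc (Max (insert 0 (fst ` ?A)))"
    let ?B = "SIGMA m:{..<M}. {..<k m}"
    have "(\<Sum>n<N. f (prod_decode n)) = (\<Sum>z\<in>?A. f z)"
      by (simp add: sum.reindex inj_prod_decode)
    also have "\<dots> = (\<Sum>z\<in>?A \<inter> ?B. f z)"
    proof (rule sum.mono_neutral_right)
      show "\<forall>z\<in>?A - ?A \<inter> ?B. f z = 0"
      proof
        fix z assume z: "z \<in> ?A - ?A \<inter> ?B"
        obtain m j where mj: "z = (m, j)" by (cases z)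
        have "m \<in> fst ` ?A" using imageI[of z ?A fst] z mj by simp
        then have "m \<le> Max (insert 0 (fst ` ?A))" by (intro Max_ge) auto
        then have "m < M" by (simp only: M_def less_Suc_eq_le)
        moreover have "z \<notin> ?B" using z by blast
        ultimately have "k m \<le> j" using mj by auto
        then show "f z = 0" unfolding mj by (rule zero)
      qed
    qed auto
    also have "\<dots> \<le> (\<Sum>z\<in>?B. f z)" using nonneg by (intro sum_mono2) auto
    also have "\<dots> = (\<Sum>m<M. \<Sum>j<k m. f (m, j))" by (simp add: sum.Sigma)
    also have "\<dots> \<le> (\<Sum>m<M. g m)" by (intro sum_mono le)
    also have "\<dots> \<le> (\<Sum>m. g m)" using g g0 by (intro sum_le_suminf) auto
    finally show ?thesis .
  qed
  show summ: "summable (\<lambda>n. f (prod_decode n))"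
    by (rule summableI_nonneg_bounded[OF _ part]) (rule nonneg)
  show "(\<Sum>n. f (prod_decode n)) \<le> (\<Sum>m. g m)"
    by (rule suminf_le_const[OF summ part])
qed

lemma blocks_le_suminf_prod_decode:
  fixes f :: "nat \<times> nat \<Rightarrow> real" and k :: "nat \<Rightarrow> nat"
  assumes nonneg: "\<And>z. 0 \<le> f z" and summ: "summable (\<lambda>n. f (prod_decode n))"
  shows "(\<Sum>m<M. \<Sum>j<k m. f (m, j)) \<le> (\<Sum>n. f (prod_decode n))"
proof -
  let ?B = "SIGMA m:{..<M}. {..<k m}"
  have "(\<Sum>m<M. \<Sum>j<k m. f (m, j)) = (\<Sum>z\<in>?B. f (prod_decode (prod_encode z)))"
    by (simp add: sum.Sigma)
  also have "\<dots> = (\<Sum>n\<in>prod_encode ` ?B. f (prod_decode n))"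
    by (subst sum.reindex) (auto simp: inj_prod_encode)
  also have "\<dots> \<le> (\<Sum>n. f (prod_decode n))"
    using nonneg by (intro sum_le_suminf summ) auto
  finally show ?thesis .
qed

lemma series_of_squares_in_polynomials2:
  fixes scal :: "'k::real_or_complex \<Rightarrow> 'x::banach \<Rightarrow> 'x" and w :: "nat \<Rightarrow> real"
  assumes \<phi>: "\<And>l. \<phi> l \<in> dual_ball scal" and w: "summable (\<lambda>l. \<bar>w l\<bar>)"
  shows "(\<lambda>x. \<Sum>l. w l *\<^sub>R (\<phi> l x * \<phi> l x)) \<in> polynomials2 scal"
proof -
  define A where "A x y = (\<Sum>l. w l *\<^sub>R (\<phi> l x * \<phi> l y))" for x y
  have le: "norm (w l *\<^sub>R (\<phi> l x * \<phi> l y)) \<le> \<bar>w l\<bar> * (norm x * norm y)" for l x y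
    using dual_ballD(3)[OF \<phi>] by (simp add: norm_mult mult_left_mono mult_mono)
  have sn: "summable (\<lambda>l. norm (w l *\<^sub>R (\<phi> l x * \<phi> l y)))" for x y
    by (rule summable_comparison_test'[OF summable_mult2[OF w, of "norm x * norm y"]]) (use le in simp)
  note s = summable_norm_cancel[OF sn]
  have add: "\<phi> l (x + y) = \<phi> l x + \<phi> l y" and mult: "\<phi> l (scal c x) = c * \<phi> l x" for l x y c
    using dual_ballD(1)[OF \<phi>[of l]] by (auto simp: Vector_Spaces.linear_iff)
  have vs: "vector_space scal" "vector_space ((*) :: 'k \<Rightarrow> 'k \<Rightarrow> 'k)"
    using dual_ballD(1)[OF \<phi>[of 0]] by (auto simp: Vector_Spaces.linear_iff)
  have comm: "A x y = A y x" for x y by (simp add: A_def mult.commute)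
  have A_add: "A x (y + z) = A x y + A x z" for x y z
    unfolding A_def using suminf_add[OF s s] by (simp add: add algebra_simps)
  have A_mult: "A x (scal c y) = c * A x y" for x y c
    unfolding A_def suminf_mult[OF s, symmetric] by (simp add: mult algebra_simps)
  have A_scaleR: "A x (c *\<^sub>R y) = c *\<^sub>R A x y" for x y c
  proof -
    have "\<phi> l (c *\<^sub>R y) = c *\<^sub>R \<phi> l y" for l
      using dual_ballD(2)[OF \<phi>] by (simp add: linear_cmul bounded_linear.linear)
    then show ?thesis unfolding A_def suminf_scaleR_right[OF s] by (simp add: algebra_simps)
  qed
  have A_le: "norm (A x y) \<le> norm x * norm y * (\<Sum>l. \<bar>w l\<bar>)" for x y
  proof -
    have "norm (A x y) \<le> (\<Sum>l. norm (w l *\<^sub>R (\<phi> l x * \<phi> l y)))"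
      unfolding A_def by (rule summable_norm[OF sn])
    also have "\<dots> \<le> (\<Sum>l. \<bar>w l\<bar> * (norm x * norm y))"
      by (rule suminf_le[OF le sn summable_mult2[OF w]])
    also have "\<dots> = norm x * norm y * (\<Sum>l. \<bar>w l\<bar>)"
      by (simp only: suminf_mult2[OF w, symmetric] mult.commute)
    finally show ?thesis .
  qed
  have "bounded_bilinear A"
    by standard (use A_add A_scaleR A_le comm in \<open>auto intro!: exI[of _ "\<Sum>l. \<bar>w l\<bar>"]\<close>)
  then have "continuous_on UNIV (\<lambda>x. A x x)"
    by (intro bounded_bilinear.continuous_on[of A] continuous_on_id)
  moreover have "Vector_Spaces.linear scal (*) (A x)" for x
    using A_add A_mult vs by (auto simp: Vector_Spaces.linear_iff)
  moreover from this have "Vector_Spaces.linear scal (*) (\<lambda>x. A x y)" for y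
    using comm by (metis (no_types, lifting) ext)
  ultimately have "(\<lambda>x. A x x) \<in> polynomials2 scal"
    unfolding polynomials2_def by blast
  then show ?thesis by (simp add: A_def)
qed

text \<open>
  With \<open>\<rho> = 1 - 1/p\<close>, the block \<open>m\<close> consists of \<open>k = 2\<^bsup>md\<^esup>\<close> vectors scaled by \<open>t\<close> and has weights \<open>c\<close>, where
  \<open>t\<^sup>r = 2\<^bsup>-m\<^esup> k\<^bsup>r\<rho> - 1\<^esup>\<close> and \<open>c = 2\<^bsup>-m\<^esup>/k\<close>.  These are chosen so that the contribution of the block is at
  most of order \<open>2\<^bsup>-m\<^esup>\<close> in the sums of \<open>|\<phi>(x\<^sub>n)|\<^sup>r\<close> and in the sum of the weights, whereas its contribution
  \<open>k c\<^bsup>r/2\<^esup> t\<^sup>r = 2\<^bsup>-m(1 + r/2)\<^esup> k\<^bsup>r(\<rho> - 1/2)\<^esup>\<close> to the diagonal sum is at least \<open>1\<close> for large \<open>d\<close>.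
\<close>

theorem exists_non_dominated_polynomial:
  fixes scal :: "'k::real_or_complex \<Rightarrow> 'x::banach \<Rightarrow> 'x"
  assumes X: "banach_space_over scal" and r: "0 < r" "r < 2"
    and p: "2 < p" "r * (1 - 1 / p) < 1" and nc: "\<not> has_cotype TYPE('x) (ereal p)"
  shows "dominated_polynomials2 scal r \<noteq> polynomials2 scal"
proof -
  define \<rho> where "\<rho> = 1 - 1 / p"
  have \<rho>: "1 / 2 < \<rho>" "r * \<rho> < 1" using p by (auto simp: \<rho>_def field_simps)
  obtain U :: "nat \<Rightarrow> nat \<Rightarrow> 'x" where U1: "\<And>k j. j < k \<Longrightarrow> 1 \<le> norm (U k j)"
    and U2: "\<And>k S \<epsilon>. S \<subseteq> {..<k} \<Longrightarrow> (\<forall>j\<in>S. \<epsilon> j \<in> {- 1, 1}) \<Longrightarrow>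
      norm (\<Sum>j\<in>S. \<epsilon> j *\<^sub>R U k j) \<le> 136 * real (card S) powr (1 / p)"
    using unconditional_upper_estimate_if_not_cotype[OF p(1) nc] by metis
  define W where "W = 272 powr r / (1 - r * \<rho>)"
  have weak: "(\<Sum>j<k. norm (\<phi> (U k j)) powr r) \<le> W * real k powr (1 - r * \<rho>)"
    if \<phi>: "\<phi> \<in> dual_ball scal" for \<phi> k
  proof -
    have "(\<Sum>j\<in>T. norm (\<phi> (U k j))) \<le> 272 * real (card T) powr (1 / p)" if T: "T \<subseteq> {..<k}" for T
      using sum_norm_le_signs[OF dual_ballD(2,3)[OF \<phi>] U2[OF T]] by simp
    then show ?thesis
      using sum_powr_le_if_weak_estimate[where S = "{..<k}" and a = "\<lambda>j. norm (\<phi> (U k j))"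
          and K = 272 and r = r and p = p] r p
      by (simp add: W_def \<rho>_def)
  qed
  obtain d :: nat where d: "(1 + r / 2) / (r * (\<rho> - 1 / 2)) \<le> real d" using real_arch_simple by blast
  have d: "1 + r / 2 \<le> real d * (r * (\<rho> - 1 / 2))"
    using d r \<rho> by (simp add: pos_divide_le_eq)
  define k where "k m = (2 ^ (m * d) :: nat)" for m
  have k: "real (k m) = 2 powr (m * d)" for m
    using powr_realpow[of 2 "m * d"] by (simp add: k_def)
  define t where "t m = 2 powr ((real m * real d * (r * \<rho> - 1) - real m) / r)" for m :: nat
  have t: "0 \<le> t m" "t m powr r = 2 powr (real m * real d * (r * \<rho> - 1) - real m)" for m
    using r by (auto simp: t_def powr_powr)
  define c where "c m = 2 powr (- real m - real m * real d)" for m :: nat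
  define xx where "xx = (\<lambda>(m, j). if j < k m then t m *\<^sub>R U (k m) j else 0)"
  define cc where "cc = (\<lambda>(m, j). if j < k m then c m else 0)"
  let ?x = "\<lambda>n. xx (prod_decode n)" and ?c = "\<lambda>n. cc (prod_decode n)"
  have geo: "summable (\<lambda>m. 2 powr (- real m))"
  proof -
    have "2 powr (- real m) = (1 / 2) ^ m" for m
      by (simp add: powr_minus powr_realpow power_one_over inverse_eq_divide)
    then show ?thesis by (simp add: summable_geometric)
  qed
  have weakly: "weakly_summable scal r ?x"
    unfolding weakly_summable_def
  proof (intro exI ballI conjI)
    fix \<phi> assume \<phi>: "\<phi> \<in> dual_ball scal"
    let ?f = "\<lambda>z. norm (\<phi> (xx z)) powr r"
    have lin: "linear \<phi>" using dual_ballD(2)[OF \<phi>] by (rule bounded_linear.linear)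
    have le: "(\<Sum>j<k m. ?f (m, j)) \<le> W * 2 powr (- real m)" for m
    proof -
      have "(\<Sum>j<k m. ?f (m, j)) = t m powr r * (\<Sum>j<k m. norm (\<phi> (U (k m) j)) powr r)"
        using t(1) unfolding sum_distrib_left
        by (intro sum.cong) (auto simp: xx_def linear_cmul[OF lin] powr_mult)
      also have "\<dots> \<le> t m powr r * (W * real (k m) powr (1 - r * \<rho>))"
        by (intro mult_left_mono weak \<phi>) simp
      also have "\<dots> = W * 2 powr (- real m)"
        by (simp add: t(2) k powr_powr powr_add[symmetric] algebra_simps)
      finally show ?thesis .
    qed
    have zero: "?f (m, j) = 0" if "k m \<le> j" for m j using that by (simp add: xx_def linear_0[OF lin])
    note B = sum_over_prod_decode_le[of ?f k, OF _ zero le summable_mult[OF geo]]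
    show "summable (\<lambda>n. ?f (prod_decode n))" by (rule B(1)) simp
    have "(\<Sum>n. ?f (prod_decode n)) \<le> (\<Sum>m. W * 2 powr (- real m))" by (rule B(2)) simp
    moreover have "0 \<le> (\<Sum>n. ?f (prod_decode n))" by (rule suminf_nonneg) (use B(1) in auto)
    ultimately show "(\<Sum>n. ?f (prod_decode n)) powr (1 / r) \<le> (\<Sum>m. W * 2 powr (- real m)) powr (1 / r)"
      using r by (intro powr_mono2) auto
  qed
  have c0: "0 \<le> cc z" for z by (cases z) (simp add: cc_def c_def)
  have summ_c: "summable ?c"
  proof (rule sum_over_prod_decode_le(1)[of cc k, OF c0 _ _ geo])
    show "(\<Sum>j<k m. cc (m, j)) \<le> 2 powr (- real m)" for m
      by (simp add: cc_def c_def k powr_add[symmetric])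
  qed (simp add: cc_def)
  have "\<forall>n. \<exists>\<phi>. \<phi> \<in> dual_ball scal \<and> norm (\<phi> (?x n)) = norm (?x n)"
    by (intro allI, rule dual_ball_norming[OF X]) blast
  then obtain \<phi> where \<phi>: "\<And>n. \<phi> n \<in> dual_ball scal" "\<And>n. norm (\<phi> n (?x n)) = norm (?x n)"
    by (auto dest!: choice)
  define a where "a i l = ?c l *\<^sub>R (\<phi> l (?x i) * \<phi> l (?x i))" for i l
  have "summable (\<lambda>l. norm (a i l))" for i
  proof (rule summable_comparison_test'[OF summable_mult2[OF summ_c, of "norm (?x i) * norm (?x i)"]])
    show "norm (norm (a i l)) \<le> ?c l * (norm (?x i) * norm (?x i))" for l
      using dual_ballD(3)[OF \<phi>(1)] c0 by (simp add: a_def norm_mult mult_left_mono mult_mono)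
  qed
  moreover have "\<not> summable (\<lambda>i. norm (a i i) powr (r / 2))"
  proof
    let ?f = "\<lambda>z. (cc z * (norm (xx z))\<^sup>2) powr (r / 2)"
    assume "summable (\<lambda>i. norm (a i i) powr (r / 2))"
    moreover have "norm (a i i) = ?c i * (norm (?x i))\<^sup>2" for i
      using c0 by (simp add: a_def norm_mult \<phi>(2) power2_eq_square)
    ultimately have summ: "summable (\<lambda>n. ?f (prod_decode n))" by simp
    have ge: "1 \<le> (\<Sum>j<k m. ?f (m, j))" for m
    proof -
      have "1 \<le> 2 powr (real m * (real d * (r * (\<rho> - 1 / 2)) - (1 + r / 2)))"
        using d by (intro ge_one_powr_ge_zero) auto
      also have "\<dots> = real (k m) * (c m powr (r / 2) * t m powr r)"
        by (simp add: k t(2) c_def powr_powr powr_add[symmetric] algebra_simps add_divide_distrib diff_divide_distrib)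
      also have "\<dots> = (\<Sum>j<k m. c m powr (r / 2) * t m powr r)" by simp
      also have "\<dots> \<le> (\<Sum>j<k m. ?f (m, j))"
      proof (rule sum_mono)
        fix j assume "j \<in> {..<k m}"
        then have j: "j < k m" by simp
        have "t m \<le> norm (xx (m, j))" using j t(1)[of m] U1[OF j] by (simp add: xx_def mult_le_cancel_left1)
        then have "t m powr r \<le> norm (xx (m, j)) powr r" using t(1) r by (intro powr_mono2) auto
        also have "\<dots> = ((norm (xx (m, j)))\<^sup>2) powr (r / 2)" by (simp add: square_powr_half)
        finally have "c m powr (r / 2) * t m powr r \<le> c m powr (r / 2) * ((norm (xx (m, j)))\<^sup>2) powr (r / 2)"
          by (rule mult_left_mono) simp
        then show "c m powr (r / 2) * t m powr r \<le> ?f (m, j)" using j by (simp add: cc_def powr_mult)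
      qed
      finally show ?thesis .
    qed
    obtain M :: nat where M: "(\<Sum>n. ?f (prod_decode n)) < real M" using reals_Archimedean2 by blast
    have "real M = (\<Sum>m<M. 1)" by simp
    also have "\<dots> \<le> (\<Sum>m<M. \<Sum>j<k m. ?f (m, j))" by (rule sum_mono) (rule ge)
    also have "\<dots> \<le> (\<Sum>n. ?f (prod_decode n))" by (rule blocks_le_suminf_prod_decode[OF _ summ]) simp
    finally show False using M by simp
  qed
  ultimately obtain b where b: "\<And>l. \<bar>b l\<bar> \<le> 1" "\<not> summable (\<lambda>i. norm (\<Sum>l. b l *\<^sub>R a i l) powr (r / 2))"
    using r not_summable_combination[of "r / 2" a] by auto
  define P where "P = (\<lambda>x. \<Sum>l. (b l * ?c l) *\<^sub>R (\<phi> l x * \<phi> l x))"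
  have "summable (\<lambda>l. \<bar>b l * ?c l\<bar>)"
    by (rule summable_comparison_test'[OF summ_c]) (use b(1) c0 in \<open>simp add: abs_mult mult_left_le_one_le\<close>)
  then have "P \<in> polynomials2 scal"
    unfolding P_def by (rule series_of_squares_in_polynomials2[OF \<phi>(1)])
  moreover have "P \<notin> dominated_polynomials2 scal r"
  proof
    assume "P \<in> dominated_polynomials2 scal r"
    then have "summable (\<lambda>i. norm (P (?x i)) powr (r / 2))"
      using weakly by (simp add: dominated_polynomials2_def)
    then show False using b(2) by (simp add: P_def a_def)
  qed
  ultimately show ?thesis by blast
qed

lemma conjugate_exponent_le_two:
  fixes q q' :: ereal
  assumes "q > 2" "1 / q + 1 / q' = 1"
  shows "q' \<le> 2"
proof (rule ccontr)
  assume "\<not> q' \<le> 2"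
  then have "q' > 2" by simp
  have half: "1 / y < 1 / 2 \<and> 0 \<le> 1 / y" if "y > 2" for y :: ereal
    using that by (cases y) (auto simp: divide_ereal_def field_simps)
  have "1 / q + 1 / q' < 1 / 2 + (1 / 2 :: ereal)"
    using half[OF assms(1)] half[OF \<open>q' > 2\<close>] by (intro ereal_add_strict_mono2) auto
  then show False using assms(2) by (simp add: one_ereal_def)
qed

theorem theorem2p7:
  fixes scal :: "'k::real_or_complex \<Rightarrow> 'x::banach \<Rightarrow> 'x"
    and q q' :: ereal
  assumes "banach_space_over scal"
    and "inf_cotype TYPE('x) = q"
    and "q > 2"
    and "1 / q + 1 / q' = 1"
  shows "(\<forall>r::real. 1 \<le> r \<and> ereal r < q' \<longrightarrow>
            dominated_polynomials2 scal r \<noteq> polynomials2 scal)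
       \<and> inf_dominated scal \<ge> q'"
proof -
  have q': "q' \<le> 2" using assms(3,4) by (rule conjugate_exponent_le_two)
  have ne: "dominated_polynomials2 scal r \<noteq> polynomials2 scal" if r: "0 < r" "r < 2" for r
  proof -
    obtain p0 where p0: "2 < p0" "ereal p0 < q" using ereal_dense2[OF assms(3)] by auto
    \<comment> \<open>The bound \<open>4 / r > 2\<close> serves because \<open>1 - 1 / p \<le> p / 4\<close>.\<close>
    define p where "p = (2 + min p0 (4 / r)) / 2"
    have p: "2 < p" "p \<le> p0" "p < 4 / r"
      using p0(1) r by (auto simp: p_def min_def field_simps)
    have "0 \<le> (p - 2)\<^sup>2" by simp
    then have "1 - 1 / p \<le> p / 4" using p(1) by (simp add: field_simps power2_eq_square)
    then have "r * (1 - 1 / p) \<le> r * (p / 4)" using r by (intro mult_left_mono) auto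
    also have "\<dots> < 1" using p(3) r by (simp add: field_simps)
    finally have rp: "r * (1 - 1 / p) < 1" .
    have "\<not> has_cotype TYPE('x) (ereal p)"
    proof
      assume "has_cotype TYPE('x) (ereal p)"
      then have "inf_cotype TYPE('x) \<le> ereal p"
        using p(1) unfolding inf_cotype_def by (intro Inf_lower) auto
      also have "\<dots> \<le> ereal p0" using p(2) by simp
      also have "\<dots> < q" by (rule p0)
      finally show False using assms(2) by simp
    qed
    then show ?thesis using exists_non_dominated_polynomial[OF assms(1) r p(1) rp] by blast
  qed
  have "ereal r < 2" if "ereal r < q'" for r using that q' by (rule less_le_trans)
  then have "\<forall>r::real. 1 \<le> r \<and> ereal r < q' \<longrightarrow> dominated_polynomials2 scal r \<noteq> polynomials2 scal"
    using ne by fastforce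
  moreover have "q' \<le> inf_dominated scal"
    unfolding inf_dominated_def
  proof (rule Inf_greatest, clarify)
    fix r :: real assume "0 < r" "dominated_polynomials2 scal r = polynomials2 scal"
    then have "2 \<le> r" using ne[of r] by force
    then have "(2 :: ereal) \<le> ereal r" by simp
    with q' show "q' \<le> ereal r" by (rule order_trans)
  qed
  ultimately show ?thesis by blast
qed

end
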